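(* For every $d \in \mathbb{N}$ and $\delta \in (0, 1/2)$, we have $N_d(X, \delta) = O_{d,\delta}(f_d(X))$ as $X \to \infty$, where $$f_d(X) := \begin{cases} X^{d/2}, & \text{if } d \equiv 3 \pmod 4,\\ X^{(d-1)/2} \log X, & \text{if } d \equiv 0 \pmod 4,\\ X^{(d-1)/2}, & \text{otherwise.}\end{cases}$$
   Context: $\mathbb{N} = \{1,2,3,\dots\}$. For $d \in \mathbb{N}$, $\delta \in (0,1/2)$ and $X > 0$, $N_d(X,\delta)$ denotes the largest integer $n$ such that there exist points $p_1, \dots, p_n$ in the closed Euclidean ball $B_d(0,X) \subset \mathbb{R}^d$ of radius $X$ centred at the origin satisfying $\|\,|p_i - p_j|\,\| \ge \delta$ for all $i \ne j$. Here $|\cdot|$ is the Euclidean norm and, for a real number $t$, $\|t\|$ is the distance from $t$ to the nearest integer. (This maximum is finite since such a point set is $\delta$-separated.) Asymptotic notation is with respect to $X \to \infty$ with $d,\delta$ fixed: $g(X) = O_{d,\delta}(f(X))$ means that there are constants $C, X_0$ depending on $d$ and $\delta$ such that $|g(X)| \le C f(X)$ for all $X \ge X_0$. *)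

theory Defs
  imports "HOL-Analysis.Analysis" "HOL-Library.Landau_Symbols"
begin

definition dist_int :: "real \<Rightarrow> real" where
  "dist_int t = \<bar>t - of_int (round t)\<bar>"

definition admissible :: "real \<Rightarrow> real \<Rightarrow> nat \<Rightarrow> (nat \<Rightarrow> real ^ 'n) \<Rightarrow> bool" where
  "admissible X \<delta> n p \<longleftrightarrow>
     (\<forall>i\<in>{1..n}. p i \<in> cball 0 X) \<and>
     (\<forall>i\<in>{1..n}. \<forall>j\<in>{1..n}. i \<noteq> j \<longrightarrow> dist_int (norm (p i - p j)) \<ge> \<delta>)"

text \<open>The dimension d is the cardinality of the index type \<open>'n\<close>, passed as a type argument.
  The maximum is taken over a finite nonempty set whenever \<open>\<delta> > 0\<close>; see
  \<open>finite_admissible\<close> and \<open>Max_points_attained\<close> below.\<close>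

definition Max_points :: "'n::finite itself \<Rightarrow> real \<Rightarrow> real \<Rightarrow> nat" where
  "Max_points _ X \<delta> = Max {n. \<exists>p :: nat \<Rightarrow> real ^ 'n. admissible X \<delta> n p}"

definition growth :: "nat \<Rightarrow> real \<Rightarrow> real" where
  "growth d X =
     (if d mod 4 = 3 then X powr (real d / 2)
      else if d mod 4 = 0 then X powr ((real d - 1) / 2) * ln X
      else X powr ((real d - 1) / 2))"

lemma dist_int_le_abs: "dist_int t \<le> \<bar>t\<bar>"
  using round_diff_minimal[of t 0] by (simp add: dist_int_def)

lemma finite_admissible:
  fixes X \<delta> :: real
  assumes "\<delta> > 0"
  shows "finite {n. \<exists>p :: nat \<Rightarrow> real ^ 'n. admissible X \<delta> n p}"
proof -
  have tb: "\<forall>e>0. \<exists>K. finite K \<and> cball (0 :: real ^ 'n) X \<subseteq> (\<Union>x\<in>K. ball x e)"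
    using compact_cball[of "0 :: real ^ 'n" X] unfolding compact_eq_totally_bounded by (rule conjunct2)
  have "0 < \<delta> / 2" using assms by simp
  from tb[rule_format, OF this]
  obtain K :: "(real ^ 'n) set" where K: "finite K \<and> cball 0 X \<subseteq> (\<Union>x\<in>K. ball x (\<delta> / 2))" ..
  have "n \<le> card K" if p: "admissible X \<delta> n p" for n and p :: "nat \<Rightarrow> real ^ 'n"
  proof -
    have "\<forall>i\<in>{1..n}. \<exists>x\<in>K. p i \<in> ball x (\<delta> / 2)"
    proof
      fix i assume "i \<in> {1..n}"
      then have "p i \<in> cball 0 X" using p by (simp add: admissible_def)
      then have "p i \<in> (\<Union>x\<in>K. ball x (\<delta> / 2))" by (rule subsetD[OF conjunct2[OF K]])
      then show "\<exists>x\<in>K. p i \<in> ball x (\<delta> / 2)" by (simp only: UN_iff)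
    qed
    then have "\<forall>i\<in>{1..n}. \<exists>x. x \<in> K \<and> p i \<in> ball x (\<delta> / 2)" by (simp only: Bex_def)
    from bchoice[OF this]
    obtain c where c: "\<forall>i\<in>{1..n}. c i \<in> K \<and> p i \<in> ball (c i) (\<delta> / 2)" ..
    have "inj_on c {1..n}"
    proof (rule inj_onI, rule ccontr)
      fix i j assume ij: "i \<in> {1..n}" "j \<in> {1..n}" "c i = c j" "i \<noteq> j"
      have "dist (c i) (p i) < \<delta> / 2" "dist (c i) (p j) < \<delta> / 2"
        using bspec[OF c ij(1)] bspec[OF c ij(2)] by (simp_all only: ij(3) mem_ball)
      then have "dist (p i) (p j) < \<delta>" by (rule dist_triangle_half_r)
      moreover have "\<delta> \<le> dist_int (norm (p i - p j))"
        using p ij(1,2,4) by (simp add: admissible_def)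
      ultimately show False
        using dist_int_le_abs[of "norm (p i - p j)"] by (simp add: dist_norm)
    qed
    moreover have "c ` {1..n} \<subseteq> K" using c by (simp add: image_subset_iff)
    ultimately have "card {1..n} \<le> card K" by (rule card_inj_on_le) (rule conjunct1[OF K])
    then show ?thesis by simp
  qed
  then have "{n. \<exists>p :: nat \<Rightarrow> real ^ 'n. admissible X \<delta> n p} \<subseteq> {..card K}" by auto
  then show ?thesis by (rule finite_subset) simp
qed

lemma Max_points_attained:
  fixes X \<delta> :: real
  assumes "\<delta> > 0"
  shows "\<exists>p :: nat \<Rightarrow> real ^ 'n. admissible X \<delta> (Max_points TYPE('n) X \<delta>) p"
proof -
  have "admissible X \<delta> 0 (\<lambda>_. 0 :: real ^ 'n)" by (simp add: admissible_def)
  then have "{n. \<exists>p :: nat \<Rightarrow> real ^ 'n. admissible X \<delta> n p} \<noteq> {}" by blast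
  from Max_in[OF finite_admissible[OF assms] this] show ?thesis
    by (simp add: Max_points_def)
qed

end

theory Submission
  imports Defs "HOL-Probability.Probability_Measure"
begin

text \<open>
  Delsarte's linear programming method. The Fourier transform \<open>Omega d \<bar>x\<bar>\<close> of the uniform measure
  on the unit sphere is positive definite, hence so is \<open>f x = \<Sum>\<^sub>k a\<^sub>k Omega d (2 \<pi> k \<bar>x\<bar>)\<close> for
  \<open>a\<^sub>k \<ge> 0\<close>. If \<open>f x \<le> -c\<close> for all far apart pairs of points, then
  \<open>0 \<le> \<Sum> f (p\<^sub>i - p\<^sub>j)\<close> yields \<open>n = O(1/c)\<close>, because each point has boundedly many near neighbours.
  Up to \<open>O(1/t)\<close>, the function \<open>t\<^bsup>(d-1)/2\<^esup> Omega d t\<close> is \<open>\<alpha> cos t + \<beta> sin t\<close>, where \<open>\<alpha> \<noteq> 0\<close> unless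
  \<open>d \<equiv> 3\<close> (mod 4). The Koebe function \<open>\<Sum> k z\<^sup>k = z / (1 - z)\<^sup>2 = -1 / \<bar>1 - z\<bar>\<^sup>2\<close> is real and negative
  on the unit circle, and its square is positive; taking \<open>a\<^sub>k\<close> from one of them, according to the sign of
  \<open>\<alpha>\<close>, makes the sines disappear and gives \<open>c\<close> of order \<open>X\<^bsup>-(d-1)/2\<^esup>\<close>. This also covers
  \<open>d \<equiv> 0\<close> (mod 4) without the logarithm. For \<open>d \<equiv> 3\<close> (mod 4) pass to dimension \<open>d + 1\<close>.
\<close>

section \<open>The uniform measure on the sphere\<close>

lemma orthogonal_transformation_measurable:
  fixes T :: "'a::euclidean_space \<Rightarrow> 'a"
  assumes "orthogonal_transformation T"
  shows "T \<in> borel_measurable borel"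
  using assms by (intro borel_measurable_continuous_onI linear_continuous_on)
    (simp add: orthogonal_transformation_def linear_conv_bounded_linear)

lemma nn_integral_lborel_reflection:
  fixes g :: "'a::euclidean_space \<Rightarrow> ennreal"
  assumes [measurable]: "g \<in> borel_measurable borel"
  shows "(\<integral>\<^sup>+x. g (y - x) \<partial>lborel) = (\<integral>\<^sup>+x. g x \<partial>lborel)"
proof -
  have "lborel = distr lborel borel (\<lambda>x. y + (-1) *\<^sub>R x)"
    using lborel_affine[of "-1" y] by (simp add: density_1)
  then have "(\<integral>\<^sup>+x. g x \<partial>lborel) = (\<integral>\<^sup>+x. g x \<partial>distr lborel borel (\<lambda>x. y + (-1) *\<^sub>R x))"
    by simp
  also have "\<dots> = (\<integral>\<^sup>+x. g (y - x) \<partial>lborel)"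
    by (subst nn_integral_distr) auto
  finally show ?thesis by simp
qed

lemma nn_integral_lborel_translation:
  fixes g :: "'a::euclidean_space \<Rightarrow> ennreal"
  assumes [measurable]: "g \<in> borel_measurable borel"
  shows "(\<integral>\<^sup>+x. g (y + x) \<partial>lborel) = (\<integral>\<^sup>+x. g x \<partial>lborel)"
proof -
  have "(\<integral>\<^sup>+x. g x \<partial>lborel) = (\<integral>\<^sup>+x. g x \<partial>distr lborel borel ((+) y))"
    by (simp add: lborel_distr_plus)
  also have "\<dots> = (\<integral>\<^sup>+x. g (y + x) \<partial>lborel)"
    by (subst nn_integral_distr) auto
  finally show ?thesis by simp
qed

lemma emeasure_lborel_unit_ball:
  "emeasure lborel (ball 0 1 :: 'a::euclidean_space set) \<noteq> 0"
  "emeasure lborel (ball 0 1 :: 'a set) < \<infinity>"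
  using emeasure_lborel_ball_finite[of "0::'a" 1] content_ball_pos[of 1 "0::'a"]
  by (auto simp: measure_def)

text \<open>The library has this only for \<open>real ^ 'n\<close> with a well-ordered index type. Here it comes from
  the uniqueness of Haar measure: for the ball \<open>B\<close>, integrate \<open>1\<^sub>B(x) 1\<^sub>A(T x + y)\<close> over \<open>x\<close> and \<open>y\<close>
  in both orders.\<close>

lemma distr_lborel_orthogonal_transformation:
  fixes T :: "'a::euclidean_space \<Rightarrow> 'a"
  assumes T: "orthogonal_transformation T"
  shows "distr lborel borel T = lborel"
proof (rule measure_eqI)
  fix A assume "A \<in> sets (distr lborel borel T)"
  then have [measurable]: "A \<in> sets borel" by simp
  note [measurable] = orthogonal_transformation_measurable[OF T]
  have lin: "linear T" using T by (simp add: orthogonal_transformation_def)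
  have nT: "norm (T x) = norm x" for x using T by (rule orthogonal_transformation_norm)
  let ?B = "{x. norm x < 1} :: 'a set" and ?A = "indicator A :: 'a \<Rightarrow> ennreal"
  let ?b = "indicator ?B :: 'a \<Rightarrow> ennreal"
  have Tx: "T x + y = T (x + inv T y)" for x y
    by (simp add: linear_add[OF lin] surj_f_inv_f[OF orthogonal_transformation_surj[OF T]])
  have "emeasure lborel ?B * emeasure lborel A
      = (\<integral>\<^sup>+x. ?b x * (\<integral>\<^sup>+y. ?A (T x + y) \<partial>lborel) \<partial>lborel)"
  proof -
    have "(\<integral>\<^sup>+y. ?A (T x + y) \<partial>lborel) = emeasure lborel A" for x
      by (simp add: nn_integral_lborel_translation)
    moreover have "(\<integral>\<^sup>+x. ?b x * c \<partial>lborel) = emeasure lborel ?B * c" for c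
      by (subst nn_integral_multc) auto
    ultimately show ?thesis by simp
  qed
  also have "\<dots> = (\<integral>\<^sup>+x. (\<integral>\<^sup>+y. ?b x * ?A (T x + y) \<partial>lborel) \<partial>lborel)"
    by (simp add: nn_integral_cmult)
  also have "\<dots> = (\<integral>\<^sup>+y. (\<integral>\<^sup>+x. ?b x * ?A (T x + y) \<partial>lborel) \<partial>lborel)"
    by (rule lborel_pair.Fubini') measurable
  \<comment> \<open>For fixed \<open>y\<close>, replace \<open>?b x\<close> by
    \<open>?b (T x)\<close>, which is the same since \<open>T\<close> preserves norms, and translate
    by \<open>inv T y\<close>. This moves \<open>y\<close> out of \<open>?A\<close> and into the
    ball, whose volume does not depend on its centre.\<close>
  also have "\<dots> = (\<integral>\<^sup>+y. (\<integral>\<^sup>+x. ?b (T x - y) * ?A (T x) \<partial>lborel) \<partial>lborel)"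
  proof (rule nn_integral_cong)
    fix y
    have "(\<integral>\<^sup>+x. ?b x * ?A (T x + y) \<partial>lborel)
        = (\<integral>\<^sup>+x. ?b (T (x + inv T y) - y) * ?A (T (x + inv T y)) \<partial>lborel)"
      by (intro nn_integral_cong) (simp add: Tx[symmetric] indicator_def nT)
    also have "\<dots> = (\<integral>\<^sup>+x. ?b (T x - y) * ?A (T x) \<partial>lborel)"
      using nn_integral_lborel_translation[of "\<lambda>x. ?b (T x - y) * ?A (T x)" "inv T y"]
      by (simp add: add.commute)
    finally show "(\<integral>\<^sup>+x. ?b x * ?A (T x + y) \<partial>lborel) = (\<integral>\<^sup>+x. ?b (T x - y) * ?A (T x) \<partial>lborel)" .
  qed
  also have "\<dots> = (\<integral>\<^sup>+x. (\<integral>\<^sup>+y. ?b (T x - y) * ?A (T x) \<partial>lborel) \<partial>lborel)"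
    by (rule lborel_pair.Fubini') measurable
  also have "\<dots> = emeasure lborel ?B * emeasure (distr lborel borel T) A"
  proof -
    have "(\<integral>\<^sup>+y. ?b (T x - y) * ?A (T x) \<partial>lborel) = emeasure lborel ?B * ?A (T x)" for x
      using nn_integral_lborel_reflection[of ?b "T x"] by (simp add: nn_integral_multc del: indicator_simps)
    moreover have "(\<integral>\<^sup>+x. ?A (T x) \<partial>lborel) = emeasure (distr lborel borel T) A"
      by (subst nn_integral_distr[of T lborel borel ?A, symmetric]) auto
    ultimately show ?thesis by (simp add: nn_integral_cmult)
  qed
  finally have eq: "emeasure lborel ?B * emeasure lborel A = emeasure lborel ?B * emeasure (distr lborel borel T) A" .
  have "emeasure lborel ?B \<noteq> 0" "emeasure lborel ?B \<noteq> \<infinity>"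
    using emeasure_lborel_unit_ball[where 'a='a] by (auto simp: ball_def)
  with eq show "emeasure (distr lborel borel T) A = emeasure lborel A"
    by (simp add: ennreal_mult_cancel_left)
qed simp

text \<open>Radial projection of the ball, so that rotation invariance is inherited from Lebesgue
  measure. The value \<open>sgn 0 = 0\<close> lies off the sphere, but the origin is a null
  set.\<close>

definition sphere_unif :: "'a::euclidean_space measure" where
  "sphere_unif = distr (uniform_measure lborel (ball 0 1)) borel sgn"

lemma sgn_measurable: "sgn \<in> borel_measurable (borel :: 'a::euclidean_space measure)"
  unfolding sgn_div_norm by measurable

lemma prob_space_sphere_unif: "prob_space (sphere_unif :: 'a::euclidean_space measure)"
  unfolding sphere_unif_def
  by (intro prob_space.prob_space_distr prob_space_uniform_measure)
    (use sgn_measurable emeasure_lborel_unit_ball[where 'a='a] in auto)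

lemma sets_sphere_unif [measurable_cong, simp]: "sets sphere_unif = sets borel"
  by (simp add: sphere_unif_def)

lemma AE_sphere_unif: "AE u in (sphere_unif :: 'a::euclidean_space measure). norm u = 1"
proof -
  have "AE x in lborel. x \<noteq> (0::'a)" by (rule AE_lborel_singleton)
  then have "AE x in uniform_measure lborel (ball (0::'a) 1). norm (sgn x) = 1"
    by (subst AE_uniform_measure) (use emeasure_lborel_unit_ball[where 'a='a] in \<open>auto simp: norm_sgn\<close>)
  then show ?thesis
    unfolding sphere_unif_def by (subst AE_distr_iff) (use sgn_measurable in auto)
qed

text \<open>An orthogonal map preserves Lebesgue measure and the unit ball, and it commutes with
  \<open>sgn\<close>.\<close>

lemma distr_sphere_unif:
  fixes T :: "'a::euclidean_space \<Rightarrow> 'a"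
  assumes T: "orthogonal_transformation T"
  shows "distr sphere_unif borel T = sphere_unif"
proof -
  note [measurable] = orthogonal_transformation_measurable[OF T] sgn_measurable
  have lin: "linear T" using T by (simp add: orthogonal_transformation_def)
  have nT: "norm (T x) = norm x" for x using T by (rule orthogonal_transformation_norm)
  have "distr (uniform_measure lborel (ball 0 1)) borel T = uniform_measure lborel (ball (0::'a) 1)"
  proof (rule measure_eqI)
    fix A assume "A \<in> sets (distr (uniform_measure lborel (ball 0 1)) borel T)"
    then have [measurable]: "A \<in> sets borel" by simp
    have "ball 0 1 \<inter> T -` A = T -` (ball 0 1 \<inter> A)" by (auto simp: nT)
    then have "emeasure lborel (ball 0 1 \<inter> T -` A) = emeasure (distr lborel borel T) (ball 0 1 \<inter> A)"
      by (simp add: emeasure_distr)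
    then have "emeasure lborel (ball 0 1 \<inter> T -` A) = emeasure lborel (ball 0 1 \<inter> A)"
      by (simp add: distr_lborel_orthogonal_transformation[OF T])
    moreover have "T -` A \<in> sets borel" using measurable_sets[of T borel borel A] by simp
    ultimately show "emeasure (distr (uniform_measure lborel (ball 0 1)) borel T) A
      = emeasure (uniform_measure lborel (ball (0::'a) 1)) A"
      by (simp add: emeasure_distr)
  qed simp
  then have "distr (distr (uniform_measure lborel (ball 0 1)) borel T) borel sgn = sphere_unif"
    by (simp add: sphere_unif_def)
  moreover have "sgn \<circ> T = T \<circ> sgn"
    by (auto simp: fun_eq_iff sgn_div_norm nT linear_scale[OF lin])
  ultimately show ?thesis
    unfolding sphere_unif_def by (simp add: distr_distr)
qed

lemma sphere_unif_rotate:
  fixes a b :: "real ^ 'n" and h :: "real \<Rightarrow> real"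
  assumes "norm a = norm b" and [measurable]: "h \<in> borel_measurable borel"
  shows "(\<integral>u. h (a \<bullet> u) \<partial>sphere_unif) = (\<integral>u. h (b \<bullet> u) \<partial>sphere_unif)"
proof -
  obtain T where T: "orthogonal_transformation T" "T a = b"
    using orthogonal_transformation_exists[OF assms(1)] .
  note [measurable] = orthogonal_transformation_measurable[OF T(1)]
  have "(\<integral>u. h (b \<bullet> u) \<partial>sphere_unif) = (\<integral>u. h (b \<bullet> u) \<partial>distr sphere_unif borel T)"
    by (simp add: distr_sphere_unif[OF T(1)])
  also have "\<dots> = (\<integral>u. h (a \<bullet> u) \<partial>sphere_unif)"
    using T by (subst integral_distr) (auto simp: orthogonal_transformation_def)
  finally show ?thesis by simp
qed

section \<open>Normalized Bessel functions\<close>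

text \<open>\<open>Omega d\<close> is the Bessel function \<open>\<Gamma>(d/2) (2/t)\<^bsup>d/2-1\<^esup> J\<^bsub>d/2-1\<^esub>(t)\<close>, normalized to be \<open>1\<close> at \<open>0\<close>.
  Having \<open>d\<close> as a number and not as a type permits recursion on the dimension.\<close>

definition Omega_coeff :: "nat \<Rightarrow> nat \<Rightarrow> real" where
  "Omega_coeff d m = (-1) ^ m / (2 ^ m * fact m * (\<Prod>i<m. real (d + 2 * i)))"

definition Omega :: "nat \<Rightarrow> real \<Rightarrow> real" where
  "Omega d t = (\<Sum>m. Omega_coeff d m * t ^ (2 * m))"

lemma abs_Omega_coeff_le:
  assumes "d > 0"
  shows "\<bar>Omega_coeff d m\<bar> \<le> 1 / fact m"
proof -
  have "1 \<le> (\<Prod>i<m. real (d + 2 * i))"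
    using assms by (intro prod_ge_1) auto
  then have "1 * fact m * 1 \<le> 2 ^ m * fact m * (\<Prod>i<m. real (d + 2 * i))"
    by (intro mult_mono) auto
  then show ?thesis
    by (simp add: Omega_coeff_def abs_mult abs_prod frac_le)
qed

lemma summable_Omega:
  assumes "d > 0"
  shows "summable (\<lambda>m. Omega_coeff d m * y ^ m)"
proof (rule summable_comparison_test'[of "\<lambda>m. inverse (fact m) * \<bar>y\<bar> ^ m"])
  show "summable (\<lambda>m. inverse (fact m) * \<bar>y\<bar> ^ m)"
    by (rule summable_exp)
  show "norm (Omega_coeff d m * y ^ m) \<le> inverse (fact m) * \<bar>y\<bar> ^ m" for m
    using abs_Omega_coeff_le[OF assms, of m]
    by (simp add: abs_mult power_abs inverse_eq_divide mult_right_mono del: times_divide_eq_left)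
qed

lemma Omega_sums:
  assumes "d > 0"
  shows "(\<lambda>m. Omega_coeff d m * (t\<^sup>2) ^ m) sums Omega d t"
  using summable_Omega[OF assms, of "t\<^sup>2"] by (simp add: Omega_def power_mult summable_sums)

lemma Omega_coeff_Suc:
  assumes "d > 0"
  shows "real (Suc m) * Omega_coeff d (Suc m) = - Omega_coeff (d + 2) m / (2 * real d)"
proof -
  have "(\<Prod>i<Suc m. real (d + 2 * i)) = real d * (\<Prod>i<m. real (d + 2 + 2 * i))"
    unfolding prod.lessThan_Suc_shift by (simp add: algebra_simps)
  then show ?thesis
    by (simp add: Omega_coeff_def divide_simps del: prod.lessThan_Suc of_nat_add)
qed

lemma Omega_coeff_shift:
  assumes "d > 0"
  shows "real d * Omega_coeff d m = real (d + 2 * m) * Omega_coeff (d + 2) m"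
proof -
  have "(\<Prod>i<m. real (d + 2 * i)) * real (d + 2 * m) = real d * (\<Prod>i<m. real (d + 2 + 2 * i))"
    using prod.lessThan_Suc_shift[of "\<lambda>i. real (d + 2 * i)" m] by (simp add: algebra_simps)
  moreover have "(\<Prod>i<m. real (d + 2 * i)) \<noteq> 0" "(\<Prod>i<m. real (d + 2 + 2 * i)) \<noteq> 0"
    using assms by auto
  ultimately show ?thesis
    by (simp add: Omega_coeff_def field_simps del: of_nat_add)
qed

text \<open>The Bessel identity \<open>(t^(-\<nu>) J_\<nu>)' = - t^(-\<nu>) J_(\<nu>+1)\<close> with
  \<open>\<nu> = d/2 - 1\<close>, obtained by differentiating the power series in the variable
  \<open>y = t\<^sup>2\<close>.\<close>

lemma Omega_has_real_derivative:
  assumes "d > 0"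
  shows "(Omega d has_real_derivative - t / real d * Omega (d + 2) t) (at t)"
proof -
  define g where "g y = (\<Sum>m. Omega_coeff d m * y ^ m)" for y
  have "(g has_real_derivative (\<Sum>m. diffs (Omega_coeff d) m * (t\<^sup>2) ^ m)) (at (t\<^sup>2))"
    unfolding g_def by (rule termdiffs_strong_converges_everywhere) (rule summable_Omega[OF assms])
  moreover have eq: "(\<lambda>m. diffs (Omega_coeff d) m * (t\<^sup>2) ^ m) = (\<lambda>m. (- 1 / (2 * real d)) * (Omega_coeff (d + 2) m * (t\<^sup>2) ^ m))"
    by (simp only: diffs_def Omega_coeff_Suc[OF assms]) simp
  then have "(\<lambda>m. diffs (Omega_coeff d) m * (t\<^sup>2) ^ m) sums ((- 1 / (2 * real d)) * Omega (d + 2) t)"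
    unfolding eq by (intro sums_mult Omega_sums) simp
  ultimately have "(g has_real_derivative ((- 1 / (2 * real d)) * Omega (d + 2) t)) (at (t\<^sup>2))"
    by (simp add: sums_iff)
  then have "((\<lambda>t. g (t\<^sup>2)) has_real_derivative ((- 1 / (2 * real d)) * Omega (d + 2) t) * (2 * t)) (at t)"
    by (rule DERIV_chain2) (auto intro!: derivative_eq_intros)
  moreover have "Omega d = (\<lambda>t. g (t\<^sup>2))"
    by (simp add: fun_eq_iff Omega_def g_def power_mult)
  ultimately show ?thesis by (simp add: mult.commute)
qed

text \<open>The three-term recurrence \<open>J_(\<nu>-1) + J_(\<nu>+1) = (2\<nu>/t) J_\<nu>\<close>
  with \<open>\<nu> = d/2\<close>, read off from the coefficients.\<close>

lemma Omega_recurrence: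
  assumes "d > 0"
  shows "t\<^sup>2 * Omega (d + 4) t = real d * (real d + 2) * (Omega (d + 2) t - Omega d t)"
proof -
  let ?c = "real d * (real d + 2)"
  define f where "f = (\<lambda>m. ?c * (Omega_coeff (d + 2) m * (t\<^sup>2) ^ m - Omega_coeff d m * (t\<^sup>2) ^ m))"
  have "f sums (?c * (Omega (d + 2) t - Omega d t))"
    unfolding f_def using assms by (intro sums_mult sums_diff Omega_sums) auto
  \<comment> \<open>Both series start with 1, so the constant term cancels and a factor
    \<open>t\<^sup>2\<close> can be taken out.\<close>
  moreover have "f 0 = 0" by (simp add: f_def Omega_coeff_def)
  ultimately have "(\<lambda>m. f (Suc m)) sums (?c * (Omega (d + 2) t - Omega d t))"
    using sums_Suc_imp[of f] sums_Suc_iff[of f] by simp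
  moreover have "f (Suc m) = t\<^sup>2 * (Omega_coeff (d + 4) m * (t\<^sup>2) ^ m)" for m
  proof -
    have "real d * (Omega_coeff (d + 2) (Suc m) - Omega_coeff d (Suc m)) = - 2 * (real (Suc m) * Omega_coeff (d + 2) (Suc m))"
      using Omega_coeff_shift[OF assms, of "Suc m"] by (simp add: algebra_simps)
    also have "\<dots> = Omega_coeff (d + 4) m / (real d + 2)"
      using Omega_coeff_Suc[of "d + 2" m] by (simp add: numeral_eq_Suc field_simps)
    finally have "(real d + 2) * (real d * (Omega_coeff (d + 2) (Suc m) - Omega_coeff d (Suc m))) = Omega_coeff (d + 4) m"
      by simp
    then have "?c * (Omega_coeff (d + 2) (Suc m) - Omega_coeff d (Suc m)) = Omega_coeff (d + 4) m"
      by (simp add: mult_ac)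
    moreover have "f (Suc m) = ?c * (Omega_coeff (d + 2) (Suc m) - Omega_coeff d (Suc m)) * (t\<^sup>2) ^ Suc m"
      unfolding f_def by (simp only: left_diff_distrib right_diff_distrib mult.assoc)
    ultimately show ?thesis by (simp add: mult_ac)
  qed
  ultimately have "(\<lambda>m. t\<^sup>2 * (Omega_coeff (d + 4) m * (t\<^sup>2) ^ m)) sums (?c * (Omega (d + 2) t - Omega d t))"
    by simp
  with sums_mult[OF Omega_sums[of "d + 4" t], of "t\<^sup>2"] show ?thesis
    by (auto dest: sums_unique2)
qed

section \<open>The Fourier transform of the sphere\<close>

lemma integrable_sphere_unif:
  fixes h :: "'a::euclidean_space \<Rightarrow> real"
  assumes "continuous_on UNIV h"
  shows "integrable sphere_unif h"
proof -
  interpret prob_space "sphere_unif :: 'a measure" by (rule prob_space_sphere_unif)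
  have "compact (h ` sphere 0 1)"
    using assms by (intro compact_continuous_image continuous_on_subset[OF assms]) auto
  then obtain B where B: "\<And>u. norm u = 1 \<Longrightarrow> \<bar>h u\<bar> \<le> B"
    by (force dest!: compact_imp_bounded simp: bounded_iff)
  show ?thesis
  proof (rule integrable_const_bound)
    show "AE u in sphere_unif. norm (h u) \<le> B"
      using AE_sphere_unif by eventually_elim (use B in auto)
    show "h \<in> borel_measurable sphere_unif"
      using borel_measurable_continuous_onI[OF assms] by simp
  qed
qed

text \<open>By rotation invariance the choice of the coordinate is irrelevant.\<close>

definition sphere_moment :: "'n::finite itself \<Rightarrow> nat \<Rightarrow> real" where
  "sphere_moment _ m = (\<integral>u. (axis undefined 1 \<bullet> (u :: real ^ 'n)) ^ m \<partial>sphere_unif)"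

lemma integral_sphere_unif_inner_power:
  fixes a :: "real ^ 'n"
  shows "(\<integral>u. (a \<bullet> u) ^ m \<partial>sphere_unif) = norm a ^ m * sphere_moment TYPE('n) m"
proof -
  have "(\<integral>u. (a \<bullet> u) ^ m \<partial>sphere_unif)
    = (\<integral>u. ((norm a *\<^sub>R axis undefined 1 :: real ^ 'n) \<bullet> u) ^ m \<partial>sphere_unif)"
    by (rule sphere_unif_rotate) auto
  also have "\<dots> = (\<integral>u. norm a ^ m * ((axis undefined 1 :: real ^ 'n) \<bullet> u) ^ m \<partial>sphere_unif)"
    by (simp only: inner_scaleR_left power_mult_distrib)
  also have "\<dots> = norm a ^ m * sphere_moment TYPE('n) m"
    unfolding sphere_moment_def by (rule integral_mult_right_zero)
  finally show ?thesis .
qed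

lemma sphere_moment_0: "sphere_moment TYPE('n::finite) 0 = 1"
  using prob_space.prob_space[OF prob_space_sphere_unif[where 'a="real^'n"]]
  by (simp add: sphere_moment_def)

text \<open>Padding to all exponents up to \<open>2 * m + 1\<close>, with zero odd coefficients,
  prepares the power for a comparison of coefficients.\<close>

lemma power_one_plus_square:
  "(1 + x\<^sup>2) ^ m = (\<Sum>i\<le>2 * m + 1. (if even i then real (m choose (i div 2)) else 0) * x ^ i)" for x :: real
proof -
  have "(1 + x\<^sup>2) ^ m = (\<Sum>i\<le>m. real (m choose i) * x ^ (2 * i))"
    using binomial_ring[of "x\<^sup>2" 1 m] by (simp add: power_mult add.commute)
  also have "\<dots> = (\<Sum>i<2 * Suc m. if even i then real (m choose (i div 2)) * x ^ i else 0)"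
    using sum_split_even_odd[of "\<lambda>i. real (m choose (i div 2)) * x ^ i" "\<lambda>_. 0" "Suc m"]
    by (simp add: lessThan_Suc_atMost)
  also have "\<dots> = (\<Sum>i\<le>2 * m + 1. (if even i then real (m choose (i div 2)) else 0) * x ^ i)"
    by (intro sum.cong) auto
  finally show ?thesis .
qed

text \<open>Compares the coefficients of \<open>x\<^sup>2\<close> in \<open>E (u\<^sub>i + x u\<^sub>j) ^ 2m = (1 + x\<^sup>2) ^ m E u\<^sub>i ^ 2m\<close>.\<close>

lemma sphere_mixed_moment:
  fixes i j :: "'n::finite"
  assumes "i \<noteq> j"
  shows "real (2 * n + 1) * (\<integral>u. (u $ i) ^ (2 * n) * (u $ j)\<^sup>2 \<partial>sphere_unif) = sphere_moment TYPE('n) (2 * n + 2)"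
proof -
  let ?M = "sphere_moment TYPE('n) (2 * n + 2)"
  define m where "m = n + 1"
  let ?E = "\<lambda>k. (\<integral>u. (u $ j) ^ k * (u $ i) ^ (2 * m - k) \<partial>(sphere_unif :: (real ^ 'n) measure))"
  have "(\<Sum>k\<le>2 * m + 1. real ((2 * m) choose k) * ?E k * x ^ k)
      = (\<Sum>k\<le>2 * m + 1. (if even k then real (m choose (k div 2)) else 0) * ?M * x ^ k)" for x :: real
  proof -
    let ?a = "x *\<^sub>R axis j 1 + axis i 1 :: real ^ 'n"
    have "?a \<bullet> ?a = 1 + x\<^sup>2"
      using assms by (simp add: inner_simps inner_axis_axis power2_eq_square)
    then have norm: "norm ?a ^ (2 * m) = (1 + x\<^sup>2) ^ m"
      by (simp add: power_mult power2_norm_eq_inner)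
    have int: "integrable sphere_unif (\<lambda>u :: real ^ 'n. (u $ j) ^ k * (u $ i) ^ l)" for k l
      by (intro integrable_sphere_unif continuous_intros)
    \<comment> \<open>The index \<open>2 * m + 1\<close>, present to match the other side, has
      binomial coefficient zero.\<close>
    have "(\<Sum>k\<le>2 * m + 1. real ((2 * m) choose k) * ?E k * x ^ k)
      = (\<Sum>k\<le>2 * m. real ((2 * m) choose k) * ?E k * x ^ k)" by simp
    also have "\<dots> = (\<Sum>k\<le>2 * m. \<integral>u. (real ((2 * m) choose k) * x ^ k) * ((u $ j) ^ k * (u $ i) ^ (2 * m - k)) \<partial>(sphere_unif :: (real ^ 'n) measure))"
      by (simp only: integral_mult_right_zero) (simp only: mult_ac)
    also have "\<dots> = (\<integral>u. (\<Sum>k\<le>2 * m. (real ((2 * m) choose k) * x ^ k) * ((u $ j) ^ k * (u $ i) ^ (2 * m - k))) \<partial>(sphere_unif :: (real ^ 'n) measure))"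
      by (rule Bochner_Integration.integral_sum[symmetric]) (intro integrable_mult_right int)
    also have "\<dots> = (\<integral>u. (?a \<bullet> u) ^ (2 * m) \<partial>(sphere_unif :: (real ^ 'n) measure))"
    proof (intro Bochner_Integration.integral_cong refl)
      fix u :: "real ^ 'n"
      have "?a \<bullet> u = x * u $ j + u $ i" by (simp add: inner_simps inner_axis')
      then show "(\<Sum>k\<le>2 * m. (real ((2 * m) choose k) * x ^ k) * ((u $ j) ^ k * (u $ i) ^ (2 * m - k))) = (?a \<bullet> u) ^ (2 * m)"
        by (simp add: binomial_ring power_mult_distrib mult.assoc mult.left_commute)
    qed
    also have "\<dots> = (1 + x\<^sup>2) ^ m * ?M"
      by (simp only: integral_sphere_unif_inner_power norm) (simp add: m_def)
    also have "\<dots> = (\<Sum>k\<le>2 * m + 1. (if even k then real (m choose (k div 2)) else 0) * ?M * x ^ k)"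
      unfolding power_one_plus_square sum_distrib_right by (simp only: mult_ac)
    finally show ?thesis .
  qed
  then have all: "\<forall>k\<le>2 * m + 1. real ((2 * m) choose k) * ?E k = (if even k then real (m choose (k div 2)) else 0) * ?M"
    by (subst polyfun_eq_coeffs[symmetric]) blast
  have "2 \<le> 2 * m + 1" by (simp add: m_def)
  then have "real ((2 * m) choose 2) * ?E 2 = (if even (2::nat) then real (m choose (2 div 2)) else 0) * ?M"
    by (rule all[rule_format])
  \<comment> \<open>Here \<open>2 * m = 2 * n + 2\<close>, so
    \<open>(2 * m) choose 2 = m * (2 * n + 1)\<close>.\<close>
  then have "real (m * (2 * n + 1)) * ?E 2 = real m * ?M"
    by (simp add: choose_two m_def algebra_simps)
  then have "real m * (real (2 * n + 1) * ?E 2) = real m * ?M"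
    by (simp only: of_nat_mult mult.assoc)
  then have "real (2 * n + 1) * ?E 2 = ?M"
    unfolding mult_cancel_left by (simp add: m_def)
  then show ?thesis
    by (simp add: m_def mult.commute)
qed

text \<open>Insert the factor \<open>\<Sum>\<^sub>j u\<^sub>j\<^sup>2 = 1\<close> into the moment of
  order \<open>2 * n\<close>. The term \<open>j = i\<close> is the next even moment; each of the
  others is a mixed moment, which is the next even moment divided by
  \<open>2 * n + 1\<close>.\<close>

lemma sphere_moment_Suc_Suc:
  "real (CARD('n) + 2 * n) * sphere_moment TYPE('n::finite) (2 * n + 2) = real (2 * n + 1) * sphere_moment TYPE('n) (2 * n)"
proof -
  let ?S = "sphere_unif :: (real ^ 'n) measure" and ?M = "sphere_moment TYPE('n)"
  obtain i :: 'n where True by simp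
  have M: "?M k = (\<integral>u. (u $ i) ^ k \<partial>?S)" for k
    using integral_sphere_unif_inner_power[of "axis i 1 :: real ^ 'n" k] by (simp add: inner_axis')
  have int: "integrable sphere_unif (\<lambda>u :: real ^ 'n. (u $ i) ^ k * (u $ j) ^ l)" for j k l
    by (intro integrable_sphere_unif continuous_intros)
  have "real (2 * n + 1) * ?M (2 * n) = real (2 * n + 1) * (\<integral>u. (u $ i) ^ (2 * n) * (\<Sum>j\<in>UNIV. (u $ j)\<^sup>2) \<partial>?S)"
    unfolding M
  proof (intro arg_cong[where f="(*) _"] integral_cong_AE)
    show "AE u in ?S. (u $ i) ^ (2 * n) = (u $ i) ^ (2 * n) * (\<Sum>j\<in>UNIV. (u $ j)\<^sup>2)"
      using AE_sphere_unif
    proof eventually_elim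
      fix u :: "real ^ 'n" assume "norm u = 1"
      then have "(\<Sum>j\<in>UNIV. (u $ j)\<^sup>2) = 1"
        by (simp add: norm_vec_def L2_set_def)
      then show "(u $ i) ^ (2 * n) = (u $ i) ^ (2 * n) * (\<Sum>j\<in>UNIV. (u $ j)\<^sup>2)" by simp
    qed
  qed measurable
  also have "(\<integral>u. (u $ i) ^ (2 * n) * (\<Sum>j\<in>UNIV. (u $ j)\<^sup>2) \<partial>?S)
      = (\<Sum>j\<in>UNIV. \<integral>u. (u $ i) ^ (2 * n) * (u $ j)\<^sup>2 \<partial>?S)"
    unfolding sum_distrib_left by (rule Bochner_Integration.integral_sum) (rule int)
  also have "real (2 * n + 1) * \<dots> = (\<Sum>j\<in>UNIV. if j = i then real (2 * n + 1) * ?M (2 * n + 2) else ?M (2 * n + 2))"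
    unfolding sum_distrib_left
    by (intro sum.cong refl) (use sphere_mixed_moment[of i _ n] in \<open>auto simp: M simp flip: power_add\<close>)
  also have "\<dots> = real (2 * n + 1) * ?M (2 * n + 2) + real (CARD('n) - 1) * ?M (2 * n + 2)"
    by (simp add: sum.remove[of UNIV i] card_Diff_singleton del: of_nat_add)
  also have "\<dots> = real (CARD('n) + 2 * n) * ?M (2 * n + 2)"
    by (simp add: of_nat_diff Suc_leI algebra_simps)
  finally show ?thesis by simp
qed

text \<open>The factor \<open>fact (2 * m)\<close> will cancel against the cosine series and leave
  exactly \<open>Omega_coeff\<close>.\<close>

lemma sphere_moment_even:
  "sphere_moment TYPE('n::finite) (2 * m) = fact (2 * m) / (2 ^ m * fact m * (\<Prod>i<m. real (CARD('n) + 2 * i)))"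
proof (induction m)
  case 0
  then show ?case by (simp add: sphere_moment_0)
next
  case (Suc m)
  have pos: "real (CARD('n) + 2 * m) \<noteq> 0" unfolding of_nat_eq_0_iff by simp
  have "sphere_moment TYPE('n) (2 * Suc m) = real (2 * m + 1) * sphere_moment TYPE('n) (2 * m) / real (CARD('n) + 2 * m)"
    using sphere_moment_Suc_Suc[where 'n='n, of m] pos by (simp add: field_simps del: of_nat_add)
  also have "\<dots> = fact (2 * Suc m) / (2 ^ Suc m * fact (Suc m) * (\<Prod>i<Suc m. real (CARD('n) + 2 * i)))"
    unfolding Suc.IH by (simp add: divide_simps)
  finally show ?case .
qed

text \<open>The cosine series is integrated term by term, which produces the even moments. Almost
  everywhere \<open>\<bar>x \<bullet> u\<bar> \<le> norm x\<close>, so the terms are dominated by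
  those of the series of \<open>cosh (norm x)\<close>.\<close>

lemma integral_sphere_unif_cos:
  fixes x :: "real ^ 'n"
  shows "(\<lambda>m. Omega_coeff CARD('n) m * norm x ^ (2 * m)) sums (\<integral>u. cos (x \<bullet> u) \<partial>sphere_unif)"
proof -
  let ?S = "sphere_unif :: (real ^ 'n) measure"
  interpret prob_space ?S by (rule prob_space_sphere_unif)
  define f where "f m u = (-1) ^ m / fact (2 * m) * (x \<bullet> u) ^ (2 * m)" for m and u :: "real ^ 'n"
  have int: "integrable ?S (f m)" for m
    unfolding f_def by (intro integrable_sphere_unif continuous_intros)
  have cosh: "summable (\<lambda>m. norm ((-1) ^ m / fact (2 * m) * y ^ (2 * m) :: real))" for y :: real
  proof (rule summable_comparison_test'[of "\<lambda>m. 1 / fact m * (y\<^sup>2) ^ m"])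
    show "summable (\<lambda>m. 1 / fact m * (y\<^sup>2) ^ m)"
      using summable_exp[of "y\<^sup>2"] by (simp add: field_simps)
    fix m :: nat
    have "fact m \<le> (fact (2 * m) :: real)" by (intro fact_mono) auto
    then show "norm (norm ((-1) ^ m / fact (2 * m) * y ^ (2 * m))) \<le> 1 / fact m * (y\<^sup>2) ^ m"
      by (simp add: abs_mult power_mult divide_simps mult_left_mono)
  qed
  have "(\<lambda>m. \<integral>u. f m u \<partial>?S) sums (\<integral>u. (\<Sum>m. f m u) \<partial>?S)"
  proof (rule sums_integral[OF int])
    show "AE u in ?S. summable (\<lambda>m. norm (f m u))"
      unfolding f_def by (intro AE_I2 cosh)
    show "summable (\<lambda>m. \<integral>u. norm (f m u) \<partial>?S)"
    proof (rule summable_comparison_test'[OF cosh[of "norm x"]])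
      fix m :: nat
      have "AE u in ?S. norm (f m u) \<le> norm ((-1) ^ m / fact (2 * m) * norm x ^ (2 * m))"
        using AE_sphere_unif
      proof eventually_elim
        fix u :: "real ^ 'n" assume "norm u = 1"
        then have "\<bar>x \<bullet> u\<bar> \<le> norm x" using Cauchy_Schwarz_ineq2[of x u] by simp
        then have "\<bar>x \<bullet> u\<bar> ^ (2 * m) \<le> norm x ^ (2 * m)" by (intro power_mono) auto
        then show "norm (f m u) \<le> norm ((-1) ^ m / fact (2 * m) * norm x ^ (2 * m))"
          by (simp add: f_def abs_mult power_abs divide_right_mono)
      qed
      then have "(\<integral>u. norm (f m u) \<partial>?S) \<le> norm ((-1) ^ m / fact (2 * m) * norm x ^ (2 * m))"
        by (intro integral_le_const integrable_norm int)
      then show "norm (\<integral>u. norm (f m u) \<partial>?S) \<le> norm ((-1) ^ m / fact (2 * m) * norm x ^ (2 * m))"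
        by simp
    qed
  qed
  moreover have "(\<Sum>m. f m u) = cos (x \<bullet> u)" for u
    unfolding f_def using cos_paired[of "x \<bullet> u"] by (rule sums_unique[symmetric])
  moreover have "(\<integral>u. f m u \<partial>?S) = Omega_coeff CARD('n) m * norm x ^ (2 * m)" for m
    unfolding f_def integral_mult_right_zero integral_sphere_unif_inner_power sphere_moment_even Omega_coeff_def
    by simp
  ultimately show ?thesis by simp
qed

lemma Omega_norm_eq_integral:
  "Omega CARD('n) (norm x) = (\<integral>u. cos (x \<bullet> u) \<partial>sphere_unif)" for x :: "real ^ 'n"
  unfolding Omega_def by (rule sums_unique[OF integral_sphere_unif_cos, symmetric])

lemma Omega_norm_le_1: "\<bar>Omega CARD('n) (norm x)\<bar> \<le> 1" for x :: "real ^ 'n"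
proof -
  let ?S = "sphere_unif :: (real ^ 'n) measure"
  interpret prob_space ?S by (rule prob_space_sphere_unif)
  have int: "integrable ?S (\<lambda>u. cos (x \<bullet> u))"
    by (intro integrable_sphere_unif continuous_intros)
  have "\<bar>\<integral>u. cos (x \<bullet> u) \<partial>?S\<bar> \<le> (\<integral>u. \<bar>cos (x \<bullet> u)\<bar> \<partial>?S)"
    using integral_norm_bound[of ?S "\<lambda>u. cos (x \<bullet> u)"] by simp
  also have "\<dots> \<le> 1"
    using int by (intro integral_le_const integrable_abs) auto
  finally show ?thesis by (simp add: Omega_norm_eq_integral)
qed

text \<open>For fixed \<open>u\<close> the double sum of cosines is the squared modulus of the
  exponential sum with phases \<open>p i \<bullet> u\<close>.\<close>

lemma Omega_positive_definite:
  fixes p :: "'i \<Rightarrow> real ^ 'n"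
  assumes "finite I"
  shows "0 \<le> (\<Sum>i\<in>I. \<Sum>j\<in>I. Omega CARD('n) (norm (p i - p j)))"
proof -
  let ?S = "sphere_unif :: (real ^ 'n) measure"
  have int: "integrable ?S (\<lambda>u. cos (x \<bullet> u))" for x
    by (intro integrable_sphere_unif continuous_intros)
  have "(\<Sum>i\<in>I. \<Sum>j\<in>I. Omega CARD('n) (norm (p i - p j)))
      = (\<integral>u. (\<Sum>i\<in>I. \<Sum>j\<in>I. cos ((p i - p j) \<bullet> u)) \<partial>?S)"
    by (simp add: Omega_norm_eq_integral Bochner_Integration.integral_sum int)
  also have "\<dots> = (\<integral>u. (\<Sum>i\<in>I. cos (p i \<bullet> u))\<^sup>2 + (\<Sum>i\<in>I. sin (p i \<bullet> u))\<^sup>2 \<partial>?S)"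
    by (simp add: inner_diff_left cos_diff sum.distrib power2_eq_square sum_product)
  also have "\<dots> \<ge> 0"
    by (intro integral_nonneg_AE AE_I2) auto
  finally show ?thesis .
qed

section \<open>Asymptotics of the Bessel functions\<close>

text \<open>\<open>f t - C / t\<close> is nondecreasing and \<open>f t + C / t\<close>
  nonincreasing; \<open>A\<close> is the supremum of the former and lies below the latter. The
  explicit \<open>C\<close> matters: it later decides the signs of two limits.\<close>

lemma convergent_of_derivative_bound:
  fixes f f' :: "real \<Rightarrow> real"
  assumes f: "\<And>t. t \<ge> 1 \<Longrightarrow> (f has_real_derivative f' t) (at t)"
    and C: "\<And>t. t \<ge> 1 \<Longrightarrow> \<bar>f' t\<bar> \<le> C / t\<^sup>2"
  shows "\<exists>A. \<forall>t\<ge>1. \<bar>f t - A\<bar> \<le> C / t"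
proof -
  have up: "f s - C / s \<le> f t - C / t" and dn: "f t + C / t \<le> f s + C / s" if "1 \<le> s" "s \<le> t" for s t
  proof -
    show "f s - C / s \<le> f t - C / t"
    proof (rule DERIV_nonneg_imp_nondecreasing[OF that(2)])
      fix x assume x: "s \<le> x" "x \<le> t"
      with that have "((\<lambda>t. f t - C / t) has_real_derivative f' x + C / x\<^sup>2) (at x)"
        by (auto intro!: derivative_eq_intros f simp: power2_eq_square)
      moreover have "f' x + C / x\<^sup>2 \<ge> 0" using C[of x] that x by linarith
      ultimately show "\<exists>y. ((\<lambda>t. f t - C / t) has_real_derivative y) (at x) \<and> 0 \<le> y" by blast
    qed
    show "f t + C / t \<le> f s + C / s"
    proof (rule DERIV_nonpos_imp_nonincreasing[OF that(2)])
      fix x assume x: "s \<le> x" "x \<le> t"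
      with that have "((\<lambda>t. f t + C / t) has_real_derivative f' x - C / x\<^sup>2) (at x)"
        by (auto intro!: derivative_eq_intros f simp: power2_eq_square)
      moreover have "f' x - C / x\<^sup>2 \<le> 0" using C[of x] that x by linarith
      ultimately show "\<exists>y. ((\<lambda>t. f t + C / t) has_real_derivative y) (at x) \<and> y \<le> 0" by blast
    qed
  qed
  have "C \<ge> 0" using C[of 1] by simp
  define A where "A = (SUP s\<in>{1..}. f s - C / s)"
  have le: "f s - C / s \<le> f t + C / t" if "1 \<le> s" "1 \<le> t" for s t
  proof (cases "s \<le> t")
    case True
    moreover have "0 \<le> C / t" using \<open>C \<ge> 0\<close> that by simp
    ultimately show ?thesis using up[of s t] that by linarith
  next
    case False
    moreover have "0 \<le> C / s" using \<open>C \<ge> 0\<close> that by simp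
    ultimately show ?thesis using dn[of t s] that by linarith
  qed
  have "\<bar>f t - A\<bar> \<le> C / t" if "t \<ge> 1" for t
  proof -
    have "f t - C / t \<le> A" unfolding A_def
      by (rule cSUP_upper) (use that le[of _ 1] in \<open>auto intro!: bdd_aboveI[of _ "f 1 + C / 1"]\<close>)
    moreover have "A \<le> f t + C / t" unfolding A_def
      by (rule cSUP_least) (use that le in auto)
    ultimately show ?thesis by linarith
  qed
  then show ?thesis by blast
qed

text \<open>Classically the leading term is a multiple of
  \<open>cos (t - (d - 1) \<pi> / 4)\<close>. The constants are left open, since the bound needs no
  more than \<open>\<alpha> \<noteq> 0\<close>.\<close>

definition Omega_asymp :: "nat \<Rightarrow> real \<Rightarrow> real \<Rightarrow> bool" where
  "Omega_asymp d \<alpha> \<beta> \<longleftrightarrow>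
    (\<exists>K. \<forall>t\<ge>1. \<bar>t powr ((real d - 1) / 2) * Omega d t - (\<alpha> * cos t + \<beta> * sin t)\<bar> \<le> K / t)"

lemma Omega_1: "Omega 1 t = cos t"
proof -
  have "Omega_coeff 1 m = (-1) ^ m / fact (2 * m)" for m
    by (induction m) (simp_all add: Omega_coeff_def divide_simps)
  with Omega_sums[of 1 t] have "(\<lambda>m. (-1) ^ m / fact (2 * m) * t ^ (2 * m)) sums Omega 1 t"
    by (simp add: power_mult)
  with cos_paired[of t] show ?thesis by (rule sums_unique2[symmetric])
qed

lemma Omega_3: "t * Omega 3 t = sin t"
proof -
  have "(cos has_real_derivative - t / real 1 * Omega (1 + 2) t) (at t)"
    using Omega_has_real_derivative[of 1 t] ext[of "Omega 1" cos, OF Omega_1] by simp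
  from DERIV_unique[OF this DERIV_cos] show ?thesis by (simp add: numeral_3_eq_3)
qed

lemma Omega_asymp_1: "Omega_asymp 1 1 0"
  unfolding Omega_asymp_def by (intro exI[of _ 0]) (simp add: Omega_1[unfolded One_nat_def])

lemma Omega_asymp_3: "Omega_asymp 3 0 1"
  unfolding Omega_asymp_def by (intro exI[of _ 0]) (simp add: Omega_3)

text \<open>In the recurrence, multiplied by \<open>t powr ((d - 1) / 2)\<close>, the term with
  \<open>Omega (d + 2)\<close> is a bounded function divided by \<open>t\<close> and goes into the
  error. The leading term thus comes from \<open>Omega d\<close> alone, and
  \<open>\<alpha> \<noteq> 0\<close> is inherited in steps of four.\<close>

lemma Omega_asymp_step:
  assumes "d > 0" "Omega_asymp d \<alpha> \<beta>" "Omega_asymp (d + 2) \<alpha>' \<beta>'"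
  shows "Omega_asymp (d + 4) (- (real d * (real d + 2)) * \<alpha>) (- (real d * (real d + 2)) * \<beta>)"
proof -
  let ?c = "real d * (real d + 2)"
  obtain K K' where
    K: "\<And>t. t \<ge> 1 \<Longrightarrow> \<bar>t powr ((real d - 1) / 2) * Omega d t - (\<alpha> * cos t + \<beta> * sin t)\<bar> \<le> K / t" and
    K': "\<And>t. t \<ge> 1 \<Longrightarrow> \<bar>t powr ((real (d + 2) - 1) / 2) * Omega (d + 2) t - (\<alpha>' * cos t + \<beta>' * sin t)\<bar> \<le> K' / t"
    using assms unfolding Omega_asymp_def by blast
  have "\<bar>t powr ((real (d + 4) - 1) / 2) * Omega (d + 4) t - (- ?c * \<alpha> * cos t + - ?c * \<beta> * sin t)\<bar>
      \<le> ?c * (\<bar>\<alpha>'\<bar> + \<bar>\<beta>'\<bar> + K' + K) / t" if t: "t \<ge> 1" for t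
  proof -
    define p where "p = t powr ((real d - 1) / 2)"
    have p2: "t powr ((real (d + 2) - 1) / 2) = p * t"
      using t powr_add[of t "(real d - 1) / 2" 1] by (simp add: p_def field_simps)
    have p4: "t powr ((real (d + 4) - 1) / 2) = p * t\<^sup>2"
      using t powr_add[of t "(real d - 1) / 2" 2] by (simp add: p_def field_simps)
    let ?X = "p * t * Omega (d + 2) t" and ?T = "\<alpha>' * cos t + \<beta>' * sin t"
    have "K' / t \<le> K'"
    proof -
      have "0 \<le> K' / t" using K'[OF t] by linarith
      then have "0 \<le> K'" using t by (simp add: zero_le_divide_iff)
      then show ?thesis using t by (simp add: divide_le_eq mult_left_le_one_le mult_le_cancel_left1)
    qed
    moreover have "\<bar>?T\<bar> \<le> \<bar>\<alpha>'\<bar> + \<bar>\<beta>'\<bar>"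
      by (rule order_trans[OF abs_triangle_ineq])
        (auto simp: abs_mult intro!: add_mono mult_left_le)
    ultimately have "\<bar>?X\<bar> \<le> \<bar>\<alpha>'\<bar> + \<bar>\<beta>'\<bar> + K'"
      using K'[OF t] unfolding p2 by linarith
    then have X: "\<bar>?X / t\<bar> \<le> (\<bar>\<alpha>'\<bar> + \<bar>\<beta>'\<bar> + K') / t"
      using t unfolding abs_divide by (simp only: abs_of_nonneg[of t]) (auto intro: divide_right_mono)
    have "t powr ((real (d + 4) - 1) / 2) * Omega (d + 4) t = p * (t\<^sup>2 * Omega (d + 4) t)"
      unfolding p4 by simp
    also have "\<dots> = ?c * (?X / t - p * Omega d t)"
      using t by (simp only: Omega_recurrence[OF assms(1)]) (simp add: field_simps)
    finally have "t powr ((real (d + 4) - 1) / 2) * Omega (d + 4) t - (- ?c * \<alpha> * cos t + - ?c * \<beta> * sin t)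
      = ?c * (?X / t - (p * Omega d t - (\<alpha> * cos t + \<beta> * sin t)))"
      by (simp add: algebra_simps)
    also have "\<bar>\<dots>\<bar> = ?c * \<bar>?X / t - (p * Omega d t - (\<alpha> * cos t + \<beta> * sin t))\<bar>"
      by (simp add: abs_mult)
    also have "\<dots> \<le> ?c * ((\<bar>\<alpha>'\<bar> + \<bar>\<beta>'\<bar> + K') / t + K / t)"
      using X K[OF t] unfolding p_def[symmetric] by (intro mult_left_mono) auto
    also have "\<dots> = ?c * (\<bar>\<alpha>'\<bar> + \<bar>\<beta>'\<bar> + K' + K) / t"
      by (simp only: add_divide_distrib times_divide_eq_right[symmetric])
    finally show ?thesis .
  qed
  then show ?thesis unfolding Omega_asymp_def by blast
qed

text \<open>The terms after the first two are dominated by a geometric series with ratio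
  \<open>1 / 4\<close> and sum \<open>1 / 48\<close>. For \<open>d = 2\<close> and
  \<open>d = 4\<close> this supplies the initial data at \<open>t = 1\<close>.\<close>

lemma Omega_at_1:
  assumes "d \<ge> 2"
  shows "\<bar>Omega d 1 - (1 - 1 / (2 * real d))\<bar> \<le> 1 / 48"
proof -
  have coeff: "\<bar>Omega_coeff d (m + 2)\<bar> \<le> 1 / 64 * (1 / 4) ^ m" for m
  proof -
    have "8 * 2 ^ m \<le> real d * (\<Prod>i<m + 1. 4)"
      using assms mult_mono[of 2 "real d" "4 * 2 ^ m" "4 * 4 ^ m"] power_mono[of 2 "4::real" m] by simp
    also have "\<dots> \<le> real d * (\<Prod>i<m + 1. real (d + 2 * Suc i))"
      using assms by (intro mult_left_mono prod_mono) auto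
    also have "\<dots> = (\<Prod>i<m + 2. real (d + 2 * i))"
      using prod.lessThan_Suc_shift[of "\<lambda>i. real (d + 2 * i)" "m + 1"] by simp
    finally have "8 * 2 ^ m \<le> (\<Prod>i<m + 2. real (d + 2 * i))" .
    moreover have "2 \<le> (fact (m + 2) :: real)"
      using fact_mono[of 2 "m + 2", where 'a=real] by (simp add: fact_2)
    ultimately have "2 ^ (m + 2) * 2 * (8 * 2 ^ m) \<le> 2 ^ (m + 2) * fact (m + 2) * (\<Prod>i<m + 2. real (d + 2 * i))"
      by (intro mult_mono) auto
    moreover have "2 ^ (m + 2) * 2 * (8 * 2 ^ m) = (64 * 4 ^ m :: real)"
      using power_mult_distrib[of 2 "2::real" m] by (simp add: power_add)
    ultimately have le: "64 * 4 ^ m \<le> 2 ^ (m + 2) * fact (m + 2) * (\<Prod>i<m + 2. real (d + 2 * i))"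
      by (simp only:)
    have "1 / (2 ^ (m + 2) * fact (m + 2) * (\<Prod>i<m + 2. real (d + 2 * i))) \<le> 1 / (64 * 4 ^ m)"
      by (rule frac_le[OF _ _ _ le]) simp_all
    moreover have "0 < (\<Prod>i<m + 2. real (d + 2 * i))"
      using assms by (intro prod_pos) auto
    ultimately show ?thesis
      by (simp only: Omega_coeff_def abs_divide abs_mult power_abs abs_of_pos) (simp add: power_one_over)
  qed
  have sums: "(\<lambda>m. Omega_coeff d m) sums Omega d 1"
    using Omega_sums[of d 1] assms by simp
  then have "(\<lambda>m. Omega_coeff d (m + 2)) sums (Omega d 1 - (\<Sum>m<2. Omega_coeff d m))"
    by (rule sums_split_initial_segment)
  moreover have "(\<Sum>m<2. Omega_coeff d m) = 1 - 1 / (2 * real d)"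
    by (simp add: Omega_coeff_def numeral_2_eq_2)
  ultimately have *: "(\<lambda>m. Omega_coeff d (m + 2)) sums (Omega d 1 - (1 - 1 / (2 * real d)))" by simp
  have geo: "(\<lambda>m. 1 / 64 * (1 / 4) ^ m) sums (1 / 48 :: real)"
    using sums_mult[OF geometric_sums[of "1 / 4 :: real"], of "1 / 64"] by simp
  have "norm (\<Sum>m. Omega_coeff d (m + 2)) \<le> (\<Sum>m. 1 / 64 * (1 / 4) ^ m)"
    by (rule norm_suminf_le) (use coeff geo in \<open>auto simp: sums_iff\<close>)
  with * geo show ?thesis by (simp add: sums_iff)
qed

lemma cos_sin_1: "1 / 2 \<le> cos (1::real)" "1 / 2 \<le> sin (1::real)"
proof -
  have "cos (pi / 3) \<le> cos 1" using pi_gt3 by (intro cos_monotone_0_pi_le) auto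
  then show "1 / 2 \<le> cos (1::real)" by (simp add: cos_60)
  have "sin (pi / 6) \<le> sin 1" using pi_gt3 pi_less_4 by (intro sin_monotone_2pi_le) auto
  then show "1 / 2 \<le> sin (1::real)" by (simp add: sin_30)
qed

text \<open>With \<open>u = a cos t + b sin t\<close> and \<open>v = a sin t - b cos t\<close>, the
  energy \<open>E = a\<^sup>2 + b\<^sup>2\<close> satisfies
  \<open>E' = 2 u v / (4 t\<^sup>2) \<le> E / (4 t\<^sup>2)\<close>. Hence
  \<open>E * exp (1 / (4 t))\<close> does not increase, and
  \<open>exp (1 / 4) \<le> 4 / 3\<close>.\<close>

lemma rotation_energy_bound:
  fixes a b :: "real \<Rightarrow> real"
  assumes a: "\<And>t. t \<ge> 1 \<Longrightarrow> (a has_real_derivative (a t * cos t + b t * sin t) * sin t / (4 * t\<^sup>2)) (at t)"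
    and b: "\<And>t. t \<ge> 1 \<Longrightarrow> (b has_real_derivative - (a t * cos t + b t * sin t) * cos t / (4 * t\<^sup>2)) (at t)"
    and t: "t \<ge> 1"
  shows "(a t)\<^sup>2 + (b t)\<^sup>2 \<le> 4 / 3 * ((a 1)\<^sup>2 + (b 1)\<^sup>2)"
proof -
  define E where "E t = (a t)\<^sup>2 + (b t)\<^sup>2" for t
  have "E t * exp (1 / (4 * t)) \<le> E 1 * exp (1 / (4 * 1))"
  proof (rule DERIV_nonpos_imp_nonincreasing[OF t])
    fix x :: real assume x: "1 \<le> x" "x \<le> t"
    let ?u = "a x * cos x + b x * sin x" and ?v = "a x * sin x - b x * cos x"
    define D where "D = (2 * ?u * ?v - E x) / (4 * x\<^sup>2) * exp (1 / (4 * x))"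
    have "((\<lambda>t. E t * exp (1 / (4 * t))) has_real_derivative D) (at x)"
      unfolding E_def D_def using x
      by (auto intro!: derivative_eq_intros a b) (simp add: divide_simps power2_eq_square, simp add: algebra_simps)
    moreover have "?u\<^sup>2 + ?v\<^sup>2 = E x"
    proof -
      have "?u\<^sup>2 + ?v\<^sup>2 = ((a x)\<^sup>2 + (b x)\<^sup>2) * ((sin x)\<^sup>2 + (cos x)\<^sup>2)"
        by algebra
      then show ?thesis by (simp add: E_def)
    qed
    then have "2 * ?u * ?v - E x \<le> 0"
      using sum_squares_bound[of ?u ?v] by simp
    then have "D \<le> 0"
      unfolding D_def by (intro mult_nonpos_nonneg divide_nonpos_nonneg) auto
    ultimately show "\<exists>y. ((\<lambda>t. E t * exp (1 / (4 * t))) has_real_derivative y) (at x) \<and> y \<le> 0" by blast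
  qed
  also have "exp (1 / (4 * 1)) \<le> (4 / 3 :: real)"
  proof -
    have "3 / 4 \<le> exp (- (1 / 4) :: real)" using exp_ge_add_one_self[of "- (1 / 4) :: real"] by simp
    then show ?thesis by (simp add: exp_minus field_simps)
  qed
  then have "E 1 * exp (1 / (4 * 1)) \<le> E 1 * (4 / 3)"
    by (intro mult_left_mono) (auto simp: E_def)
  finally have "E t * exp (1 / (4 * t)) \<le> E 1 * (4 / 3)" .
  moreover have "E t * 1 \<le> E t * exp (1 / (4 * t))"
    using t by (intro mult_left_mono) (auto simp: E_def)
  ultimately show ?thesis by (simp add: E_def)
qed

text \<open>For \<open>d = 2\<close> the function \<open>u t = sqrt t * Omega 2 t\<close> satisfies \<open>u'' + (1 + 1 / (4 t\<^sup>2)) u = 0\<close>, so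
  \<open>(a, b)\<close>, which is \<open>(u, u')\<close> rotated by the angle \<open>t\<close>, varies by \<open>O(1/t)\<close>. Since the total variation
  on \<open>[1, \<infinity>)\<close> is less than \<open>a 1\<close> and \<open>b 1\<close>, both limits are positive.\<close>

lemma Omega_asymp_2_4:
  "\<exists>A B. A > 0 \<and> B > 0 \<and> Omega_asymp 2 A B \<and> Omega_asymp 4 (- 2 * B) (2 * A)"
proof -
  define u where "u t = sqrt t * Omega 2 t" for t
  \<comment> \<open>This is \<open>u'\<close>, with the derivative of \<open>Omega 2\<close>
    expressed by \<open>Omega 4\<close>.\<close>
  define w where "w t = Omega 2 t / (2 * sqrt t) - sqrt t * t / 2 * Omega 4 t" for t
  define a where "a t = u t * cos t - w t * sin t" for t
  define b where "b t = u t * sin t + w t * cos t" for t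
  have u_ab: "u t = a t * cos t + b t * sin t" and w_ab: "w t = b t * cos t - a t * sin t" for t
  proof -
    have "a t * cos t + b t * sin t = u t * ((sin t)\<^sup>2 + (cos t)\<^sup>2)"
      "b t * cos t - a t * sin t = w t * ((sin t)\<^sup>2 + (cos t)\<^sup>2)"
      unfolding a_def b_def by algebra+
    then show "u t = a t * cos t + b t * sin t" "w t = b t * cos t - a t * sin t" by simp_all
  qed
  have dO2: "(Omega 2 has_real_derivative - t / 2 * Omega 4 t) (at t)" for t
    using Omega_has_real_derivative[of 2 t] by simp
  have dO4: "(Omega 4 has_real_derivative - t / 4 * Omega 6 t) (at t)" for t
    using Omega_has_real_derivative[of 4 t] by simp
  have O6: "t * t * Omega 6 t = 8 * (Omega 4 t - Omega 2 t)" for t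
    using Omega_recurrence[of 2 t] by (simp add: power2_eq_square)
  have du: "(u has_real_derivative w t) (at t)" if "t \<ge> 1" for t
    unfolding u_def[abs_def] w_def using that
    by (auto intro!: derivative_eq_intros dO2 simp: field_simps)
  \<comment> \<open>Bessel's equation: differentiating \<open>Omega 4\<close> brings in
    \<open>Omega 6\<close>, which the recurrence eliminates.\<close>
  have dw: "(w has_real_derivative - u t - u t / (4 * t\<^sup>2)) (at t)" if t: "t \<ge> 1" for t
  proof -
    define s where "s = sqrt t"
    have s: "s > 0" "t = s * s" "sqrt t = s" using t by (auto simp: s_def)
    have O6': "Omega 6 t = 8 * (Omega 4 t - Omega 2 t) / (t * t)"
      using O6[of t] t by (simp add: field_simps)
    show ?thesis
      unfolding w_def[abs_def] u_def using t
      apply (auto intro!: derivative_eq_intros dO2 dO4)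
      unfolding O6'
      apply (simp add: s(3))
      unfolding s(2) using s(1)
      apply (simp add: divide_simps power2_eq_square)
      apply (simp add: algebra_simps)
      done
  qed
  have da: "(a has_real_derivative (a t * cos t + b t * sin t) * sin t / (4 * t\<^sup>2)) (at t)" if "t \<ge> 1" for t
    unfolding u_ab[symmetric] unfolding a_def[abs_def] using that
    by (auto intro!: derivative_eq_intros du dw) (simp add: algebra_simps)
  have db: "(b has_real_derivative - (a t * cos t + b t * sin t) * cos t / (4 * t\<^sup>2)) (at t)" if "t \<ge> 1" for t
    unfolding u_ab[symmetric] unfolding b_def[abs_def] using that
    by (auto intro!: derivative_eq_intros du dw) (simp add: algebra_simps)
  have O2: "35 / 48 \<le> Omega 2 1" "Omega 2 1 \<le> 37 / 48" and O4: "41 / 48 \<le> Omega 4 1" "Omega 4 1 \<le> 43 / 48"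
  proof -
    have "\<bar>Omega 2 1 - 3 / 4\<bar> \<le> 1 / 48" "\<bar>Omega 4 1 - 7 / 8\<bar> \<le> 1 / 48"
      using Omega_at_1[of 2] Omega_at_1[of 4] by simp_all
    then show "35 / 48 \<le> Omega 2 1" "Omega 2 1 \<le> 37 / 48" "41 / 48 \<le> Omega 4 1" "Omega 4 1 \<le> 43 / 48"
      by linarith+
  qed
  have u1: "35 / 48 \<le> u 1" "u 1 \<le> 37 / 48" and w1: "- 1 / 12 \<le> w 1" "w 1 \<le> - 1 / 24"
    using O2 O4 by (auto simp: u_def w_def)
  have "(a 1)\<^sup>2 + (b 1)\<^sup>2 = ((u 1)\<^sup>2 + (w 1)\<^sup>2) * ((sin 1)\<^sup>2 + (cos 1)\<^sup>2)"
    unfolding a_def b_def by algebra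
  also have "\<dots> = (u 1)\<^sup>2 + (- w 1)\<^sup>2" by simp
  also have "\<dots> \<le> (37 / 48)\<^sup>2 + (1 / 12)\<^sup>2"
    using u1 w1 by (intro add_mono power_mono) auto
  \<comment> \<open>The left side is at most about 0.802, so 0.81 leaves room.\<close>
  finally have E1: "4 / 3 * ((a 1)\<^sup>2 + (b 1)\<^sup>2) \<le> (9 / 10)\<^sup>2" by (simp add: power2_eq_square)
  have E: "(a t)\<^sup>2 + (b t)\<^sup>2 \<le> (9 / 10)\<^sup>2" if "t \<ge> 1" for t
    using rotation_energy_bound[OF da db that] E1 by linarith
  have u: "\<bar>u t\<bar> \<le> 9 / 10" if "t \<ge> 1" for t
  proof -
    have "(u t)\<^sup>2 + (w t)\<^sup>2 = ((a t)\<^sup>2 + (b t)\<^sup>2) * ((sin t)\<^sup>2 + (cos t)\<^sup>2)"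
      unfolding u_ab w_ab by algebra
    then have "(u t)\<^sup>2 \<le> (9 / 10)\<^sup>2" using E[OF that] by (simp add: add_increasing2) (smt (verit) zero_le_power2)
    then show ?thesis using abs_le_square_iff[of "u t" "9 / 10"] by simp
  qed
  \<comment> \<open>With \<open>\<bar>u t\<bar> \<le> 9 / 10\<close> the derivatives of
    \<open>a\<close> and \<open>b\<close> are at most \<open>9 / 40 / t\<^sup>2\<close>, so
    \<open>a 1\<close> and \<open>b 1\<close> are within \<open>9 / 40\<close> of the
    limits.\<close>
  have ab: "\<bar>u t * s / (4 * t\<^sup>2)\<bar> \<le> 9 / 40 / t\<^sup>2" if "t \<ge> 1" "\<bar>s\<bar> \<le> 1" for t s
  proof -
    have "\<bar>u t\<bar> * \<bar>s\<bar> \<le> 9 / 10 * 1" using u[OF that(1)] that by (intro mult_mono) auto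
    then show ?thesis using that by (simp add: abs_mult divide_simps mult.commute)
  qed
  obtain A where A: "\<And>t. t \<ge> 1 \<Longrightarrow> \<bar>a t - A\<bar> \<le> 9 / 40 / t"
    using convergent_of_derivative_bound[OF da, of "9 / 40"] ab[of _ "sin _"] by (auto simp flip: u_ab)
  obtain B where B: "\<And>t. t \<ge> 1 \<Longrightarrow> \<bar>b t - B\<bar> \<le> 9 / 40 / t"
    using convergent_of_derivative_bound[OF db, of "9 / 40"] ab[of _ "cos _"] by (auto simp flip: u_ab)
  \<comment> \<open>\<open>a 1 \<ge> 35 / 96\<close>, which exceeds \<open>9 / 40\<close>.\<close>
  have "A > 0"
  proof -
    have "35 / 48 * (1 / 2) \<le> u 1 * cos 1" using u1 cos_sin_1 by (intro mult_mono) auto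
    moreover have "w 1 * sin 1 \<le> 0" using w1 cos_sin_1 by (intro mult_nonpos_nonneg) auto
    moreover have "\<bar>a 1 - A\<bar> \<le> 9 / 40" using A[of 1] by simp
    ultimately show ?thesis unfolding a_def by linarith
  qed
  \<comment> \<open>The negative \<open>w 1\<close> now works against the bound, but
    \<open>35 / 96 - 1 / 12 = 9 / 32\<close> still exceeds \<open>9 / 40\<close>.\<close>
  moreover have "B > 0"
  proof -
    have "35 / 48 * (1 / 2) \<le> u 1 * sin 1" using u1 cos_sin_1 by (intro mult_mono) auto
    moreover have "- w 1 * cos 1 \<le> 1 / 12 * 1" using w1 cos_sin_1 by (intro mult_mono) auto
    moreover have "\<bar>b 1 - B\<bar> \<le> 9 / 40" using B[of 1] by simp
    ultimately show ?thesis unfolding b_def by linarith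
  qed
  moreover have comb: "\<bar>x * p + y * q\<bar> \<le> 9 / 20 / t" if "\<bar>x\<bar> \<le> 9 / 40 / t" "\<bar>y\<bar> \<le> 9 / 40 / t" "\<bar>p\<bar> \<le> 1" "\<bar>q\<bar> \<le> 1" for x y p q t :: real
  proof -
    have "\<bar>x * p\<bar> \<le> 9 / 40 / t" "\<bar>y * q\<bar> \<le> 9 / 40 / t"
      unfolding abs_mult using that by (meson abs_ge_zero mult_left_le order_trans)+
    then show ?thesis using abs_triangle_ineq[of "x * p" "y * q"] by linarith
  qed
  have "Omega_asymp 2 A B"
    unfolding Omega_asymp_def
  proof (intro exI allI impI)
    fix t :: real assume t: "t \<ge> 1"
    have "t powr ((real 2 - 1) / 2) * Omega 2 t - (A * cos t + B * sin t) = (a t - A) * cos t + (b t - B) * sin t"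
      using t u_ab[of t] by (simp add: u_def powr_half_sqrt algebra_simps)
    then show "\<bar>t powr ((real 2 - 1) / 2) * Omega 2 t - (A * cos t + B * sin t)\<bar> \<le> 9 / 20 / t"
      using comb[OF A[OF t] B[OF t], of "cos t" "sin t"] by simp
  qed
  \<comment> \<open>Solving the definition of \<open>w\<close> for \<open>Omega 4\<close> gives
    \<open>t powr (3 / 2) * Omega 4 t = u t / t - 2 * w t\<close>, and \<open>w\<close> tends to
    \<open>B cos t - A sin t\<close>.\<close>
  moreover have "Omega_asymp 4 (- 2 * B) (2 * A)"
    unfolding Omega_asymp_def
  proof (intro exI allI impI)
    fix t :: real assume t: "t \<ge> 1"
    have p: "t powr (3 / 2) = sqrt t * t"
      using t powr_add[of t "1 / 2" 1] by (simp add: powr_half_sqrt)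
    have "sqrt t * t * Omega 4 t = u t / t - 2 * w t"
      using t by (simp add: u_def w_def field_simps flip: power2_eq_square)
    then have eq: "t powr ((real 4 - 1) / 2) * Omega 4 t - (- 2 * B * cos t + 2 * A * sin t)
        = u t / t - 2 * ((a t - A) * (- sin t) + (b t - B) * cos t)"
      using w_ab[of t] p by (simp add: algebra_simps)
    have ut: "\<bar>u t / t\<bar> \<le> 9 / 10 / t"
      using divide_right_mono[OF u[OF t], of t] t by simp
    show "\<bar>t powr ((real 4 - 1) / 2) * Omega 4 t - (- 2 * B * cos t + 2 * A * sin t)\<bar> \<le> 9 / 5 / t"
    proof -
      define S where "S = (a t - A) * (- sin t) + (b t - B) * cos t"
      have "\<bar>S\<bar> \<le> 9 / 20 / t"
        unfolding S_def using A[OF t] B[OF t] by (rule comb) auto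
      moreover have "\<bar>u t / t - 2 * S\<bar> \<le> \<bar>u t / t\<bar> + 2 * \<bar>S\<bar>" by linarith
      moreover have "9 / 5 / t = 9 / 10 / t + 2 * (9 / 20 / t)" by simp
      ultimately have "\<bar>u t / t - 2 * S\<bar> \<le> 9 / 5 / t"
        using ut by linarith
      then show ?thesis unfolding eq S_def .
    qed
  qed
  ultimately show ?thesis by blast
qed

text \<open>Induction in steps of four from the base cases 1 to 4, so the residue modulo 4 is
  preserved. The hypothesis for \<open>d - 2\<close> enters through boundedness, that for
  \<open>d - 4\<close> carries \<open>\<alpha> \<noteq> 0\<close>.\<close>

lemma Omega_asymp_exists:
  assumes "d > 0"
  shows "\<exists>\<alpha> \<beta>. Omega_asymp d \<alpha> \<beta> \<and> (d mod 4 \<noteq> 3 \<longrightarrow> \<alpha> \<noteq> 0)"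
  using assms
proof (induction d rule: less_induct)
  case (less d)
  show ?case
  proof (cases "d \<le> 4")
    case True
    with less.prems consider "d = 1" | "d = 2" | "d = 3" | "d = 4" by linarith
    then show ?thesis
    proof cases
      case 1
      then show ?thesis using Omega_asymp_1 by (intro exI[of _ 1] exI[of _ 0]) auto
    next
      case 2
      then show ?thesis using Omega_asymp_2_4 by (metis less_irrefl)
    next
      case 3
      then show ?thesis using Omega_asymp_3 by (intro exI[of _ 0] exI[of _ 1]) auto
    next
      case 4
      obtain A B where "B > 0" "Omega_asymp 4 (- 2 * B) (2 * A)" using Omega_asymp_2_4 by blast
      then show ?thesis using 4 by (intro exI[of _ "- 2 * B"] exI[of _ "2 * A"]) auto
    qed
  next
    case False
    define e where "e = d - 4"
    have e: "d = e + 4" "e > 0" using False by (auto simp: e_def)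
    obtain \<alpha> \<beta> where 1: "Omega_asymp e \<alpha> \<beta>" "e mod 4 \<noteq> 3 \<longrightarrow> \<alpha> \<noteq> 0"
      using less.IH[of e] e by auto
    obtain \<alpha>' \<beta>' where 2: "Omega_asymp (e + 2) \<alpha>' \<beta>'"
      using less.IH[of "e + 2"] e by auto
    have "- (real e * (real e + 2)) \<noteq> 0" using e by auto
    then show ?thesis
      using Omega_asymp_step[OF e(2) 1(1) 2] 1(2) e(1) by (metis mod_add_self2 mult_eq_0_iff)
  qed
qed

section \<open>Trigonometric polynomials with nonnegative coefficients\<close>

text \<open>If \<open>s\<close> is the signed distance from \<open>t\<close> to the nearest integer,
  the modulus is \<open>2 sin (pi \<bar>s\<bar>)\<close>, and sine increases up to
  \<open>pi / 2\<close>. The separation condition thus keeps \<open>z = cis (2 * pi * t)\<close>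
  away from the pole of the Koebe function.\<close>

lemma cis_minus_1_norm_ge:
  assumes "0 < \<delta>" "\<delta> \<le> dist_int t"
  shows "2 * sin (pi * \<delta>) \<le> cmod (1 - cis (2 * pi * t))"
proof -
  define s where "s = t - of_int (round t)"
  have s: "\<delta> \<le> \<bar>s\<bar>" "\<bar>s\<bar> \<le> 1 / 2"
    using assms of_int_round_abs_le[of t] by (auto simp: s_def dist_int_def abs_minus_commute)
  have "cis (2 * pi * t) = cis (2 * pi * s + 2 * pi * of_int (round t))"
    by (simp add: s_def algebra_simps)
  also have "\<dots> = cis (2 * pi * s) * cis (2 * pi * of_int (round t))"
    by (rule cis_mult[symmetric])
  also have "\<dots> = cis (2 * pi * s)"
    by (simp add: cis_multiple_2pi)
  finally have cis: "cis (2 * pi * t) = cis (2 * pi * s)" .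
  have "(cmod (1 - cis (2 * pi * s)))\<^sup>2 = 2 - 2 * cos (2 * (pi * s))"
    using sin_cos_squared_add[of "2 * pi * s"] by (simp add: cmod_power2 power2_diff algebra_simps)
  also have "\<dots> = (2 * sin (pi * \<bar>s\<bar>))\<^sup>2"
    by (simp only: cos_double_sin) (simp add: abs_if power2_eq_square)
  finally have "cmod (1 - cis (2 * pi * t)) = \<bar>2 * sin (pi * \<bar>s\<bar>)\<bar>"
    unfolding cis by (metis abs_norm_cancel power2_eq_iff abs_minus_cancel)
  moreover have "sin (pi * \<delta>) \<le> sin (pi * \<bar>s\<bar>)"
    using s assms pi_gt_zero mult_left_mono[of "\<bar>s\<bar>" "1 / 2" pi]
    by (intro sin_monotone_2pi_le) (auto intro: order_trans[of _ 0])
  ultimately show ?thesis by simp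
qed

text \<open>On the circle \<open>cnj z\<close> is the inverse of \<open>z\<close>, hence
  \<open>(1 - z)\<^sup>2 = - z \<bar>1 - z\<bar>\<^sup>2\<close>.\<close>

lemma koebe_on_circle:
  assumes "cmod z = 1" "z \<noteq> 1"
  shows "z / (1 - z)\<^sup>2 = - complex_of_real (1 / (cmod (1 - z))\<^sup>2)"
proof -
  have zz: "z * cnj z = 1" using assms by (simp add: complex_norm_square[symmetric])
  then have "(1 - z)\<^sup>2 = - z * ((1 - z) * cnj (1 - z))"
    by (simp add: power2_eq_square algebra_simps)
  also have "(1 - z) * cnj (1 - z) = complex_of_real ((cmod (1 - z))\<^sup>2)"
    by (rule complex_norm_square[symmetric])
  finally show ?thesis
    using assms by (auto simp: field_simps)
qed

text \<open>The Koebe series diverges on the circle, so it is evaluated at \<open>\<rho> z\<close>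
  with \<open>\<rho> < 1\<close> and then truncated; the coefficients stay nonnegative. Truncation
  and the passage from \<open>\<rho> z\<close> to \<open>z\<close> cost
  \<open>\<epsilon> / 2\<close> each.\<close>

lemma abel_koebe_approx:
  assumes "\<eta> > 0" "\<epsilon> > 0"
  shows "\<exists>K. \<exists>\<rho>\<ge>0. \<forall>z. cmod z = 1 \<longrightarrow> \<eta> \<le> cmod (1 - z) \<longrightarrow>
    cmod ((\<Sum>k<K. of_real (real (Suc k) * \<rho> ^ Suc k) * z ^ Suc k) - z / (1 - z)\<^sup>2) \<le> \<epsilon>"
proof -
  \<comment> \<open>Chosen to make the second error, bounded below by means of \<open>half\<close>,
    at most \<open>8 * (1 - \<rho>) / \<eta> ^ 4 \<le> \<epsilon> / 2\<close>.\<close>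
  define \<rho> where "\<rho> = max (1 / 2) (1 - \<epsilon> * \<eta> ^ 4 / 16)"
  have \<rho>: "1 / 2 \<le> \<rho>" "\<rho> < 1" "8 * (1 - \<rho>) / \<eta> ^ 4 \<le> \<epsilon> / 2"
    using assms by (auto simp: \<rho>_def divide_simps max_def)
  define g where "g k = real (Suc k) * \<rho> ^ k" for k
  have sg: "summable g"
    using geometric_deriv_sums[of \<rho>] \<rho> by (auto simp: g_def[abs_def] sums_iff)
  obtain K where K: "(\<Sum>k. g (k + K)) < \<epsilon> / 2"
  proof -
    have "\<exists>N. \<forall>n\<ge>N. norm (\<Sum>k. g (k + n)) < \<epsilon> / 2"
      using suminf_exist_split[OF _ sg, of "\<epsilon> / 2"] assms by auto
    then obtain K where "norm (\<Sum>k. g (k + K)) < \<epsilon> / 2" by blast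
    then have "(\<Sum>k. g (k + K)) < \<epsilon> / 2" by simp
    then show ?thesis by (rule that)
  qed
  have "cmod ((\<Sum>k<K. of_real (real (Suc k) * \<rho> ^ Suc k) * z ^ Suc k) - z / (1 - z)\<^sup>2) \<le> \<epsilon>"
    if z: "cmod z = 1" "\<eta> \<le> cmod (1 - z)" for z
  proof -
    define w where "w = of_real \<rho> * z"
    have w: "cmod w < 1" "cmod w \<le> 1" using z \<rho> by (simp_all add: w_def norm_mult)
    let ?f = "\<lambda>k. w * (of_nat (Suc k) * w ^ k)"
    have f: "?f sums (w * (1 / (1 - w)\<^sup>2))"
      by (intro sums_mult geometric_deriv_sums w)
    have "(\<lambda>k. ?f (k + K)) sums (w * (1 / (1 - w)\<^sup>2) - (\<Sum>k<K. ?f k))"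
      using f by (rule sums_split_initial_segment)
    then have "w * (1 / (1 - w)\<^sup>2) - (\<Sum>k<K. ?f k) = (\<Sum>k. ?f (k + K))" by (simp add: sums_iff)
    moreover have "cmod (\<Sum>k. ?f (k + K)) \<le> (\<Sum>k. g (k + K))"
    proof (rule norm_suminf_le)
      show "summable (\<lambda>k. g (k + K))" using sg by (rule summable_ignore_initial_segment)
      fix k
      have "cmod (?f (k + K)) \<le> 1 * cmod (of_nat (Suc (k + K)) * w ^ (k + K))"
        unfolding norm_mult[of w] using w by (intro mult_right_mono) auto
      also have "\<dots> = g (k + K)"
        using z \<rho> by (simp add: g_def w_def norm_mult norm_power del: of_nat_Suc)
      finally show "cmod (?f (k + K)) \<le> g (k + K)" .
    qed
    moreover have "(\<Sum>k<K. ?f k) = (\<Sum>k<K. of_real (real (Suc k) * \<rho> ^ Suc k) * z ^ Suc k)"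
      by (intro sum.cong) (auto simp: w_def power_mult_distrib)
    ultimately have 1: "cmod ((\<Sum>k<K. of_real (real (Suc k) * \<rho> ^ Suc k) * z ^ Suc k) - w / (1 - w)\<^sup>2) < \<epsilon> / 2"
      using K by (simp add: norm_minus_commute)
    \<comment> \<open>\<open>w\<close> lies on the radius to \<open>z\<close>, so its distance to
      \<open>z\<close> is its distance to the circle, which is at most its distance to 1.\<close>
    have half: "cmod (1 - z) / 2 \<le> cmod (1 - w)"
    proof -
      have "cmod (1 - z) \<le> cmod (1 - w) + cmod (w - z)"
        using norm_triangle_ineq[of "1 - w" "w - z"] by simp
      also have "w - z = of_real (\<rho> - 1) * z" by (simp add: w_def algebra_simps)
      also have "cmod \<dots> = 1 - cmod w"
        unfolding w_def norm_mult norm_of_real using z \<rho> by simp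
      also have "1 - cmod w \<le> cmod (1 - w)" using norm_triangle_ineq2[of 1 w] by simp
      finally show ?thesis by simp
    qed
    have nz: "1 - z \<noteq> 0" "1 - w \<noteq> 0" using z half assms by auto
    have "w / (1 - w)\<^sup>2 - z / (1 - z)\<^sup>2 = (w - z) * (1 - w * z) / ((1 - w)\<^sup>2 * (1 - z)\<^sup>2)"
    proof -
      have "w * (1 - z)\<^sup>2 - z * (1 - w)\<^sup>2 = (w - z) * (1 - w * z)" by algebra
      then show ?thesis using nz by (subst diff_frac_eq) auto
    qed
    also have "cmod \<dots> = (1 - \<rho>) * cmod (1 - w * z) / ((cmod (1 - w))\<^sup>2 * (cmod (1 - z))\<^sup>2)"
    proof -
      have "w - z = of_real (\<rho> - 1) * z" by (simp add: w_def algebra_simps)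
      then have "cmod (w - z) = \<bar>\<rho> - 1\<bar> * cmod z" by (simp only: norm_mult norm_of_real)
      then have "cmod (w - z) = 1 - \<rho>" using z \<rho> by simp
      then show ?thesis by (simp add: norm_mult norm_divide norm_power)
    qed
    also have "\<dots> \<le> (1 - \<rho>) * 2 / ((\<eta> / 2)\<^sup>2 * \<eta>\<^sup>2)"
    proof (rule frac_le)
      have "cmod (1 - w * z) \<le> 1 + cmod (w * z)" using norm_triangle_ineq4[of 1 "w * z"] by simp
      also have "\<dots> \<le> 2" using w z by (simp add: norm_mult)
      finally show "(1 - \<rho>) * cmod (1 - w * z) \<le> (1 - \<rho>) * 2" using \<rho> by (intro mult_left_mono) auto
      show "(\<eta> / 2)\<^sup>2 * \<eta>\<^sup>2 \<le> (cmod (1 - w))\<^sup>2 * (cmod (1 - z))\<^sup>2"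
        using z half assms by (intro mult_mono power_mono) auto
    qed (use \<rho> assms in auto)
    also have "\<dots> = 8 * (1 - \<rho>) / \<eta> ^ 4" by (simp add: power2_eq_square power4_eq_xxxx)
    finally have "cmod (w / (1 - w)\<^sup>2 - z / (1 - z)\<^sup>2) \<le> \<epsilon> / 2" using \<rho> by linarith
    with 1 show ?thesis
      using norm_triangle_ineq[of "(\<Sum>k<K. of_real (real (Suc k) * \<rho> ^ Suc k) * z ^ Suc k) - w / (1 - w)\<^sup>2" "w / (1 - w)\<^sup>2 - z / (1 - z)\<^sup>2"]
      by simp
  qed
  with \<rho> show ?thesis by (intro exI[of _ K] exI[of _ \<rho>]) auto
qed

text \<open>With \<open>q = 1 / \<bar>1 - z\<bar>\<^sup>2 \<ge> 1 / 4\<close>, the truncated Koebe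
  series is close to \<open>- q\<close>; this serves \<open>s = 1\<close>. Its square is close to
  \<open>q\<^sup>2 \<ge> 1 / 16\<close> and again has nonnegative coefficients; this serves
  \<open>s = - 1\<close>.\<close>

lemma signed_kernel:
  assumes "\<eta> > 0" "\<epsilon> > 0" "s = 1 \<or> s = - 1"
  shows "\<exists>N. \<exists>b :: nat \<Rightarrow> real. b 0 = 0 \<and> (\<forall>k. 0 \<le> b k) \<and>
    (\<forall>z. cmod z = 1 \<longrightarrow> \<eta> \<le> cmod (1 - z) \<longrightarrow>
      (\<exists>q. 1 / 16 \<le> q \<and> cmod ((\<Sum>k\<le>N. of_real (b k) * z ^ k) + of_real (s * q)) \<le> \<epsilon>))"
proof -
  \<comment> \<open>From \<open>F\<^sup>2 - q\<^sup>2 = (F + q) * ((F + q) - 2 q)\<close>, an error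
    \<open>\<epsilon>' \<le> 1\<close> in \<open>F\<close> becomes at most
    \<open>\<epsilon>' * M\<close> in the square.\<close>
  define M where "M = 2 / \<eta>\<^sup>2 + 1"
  have M: "M \<ge> 1" unfolding M_def by simp
  define \<epsilon>' where "\<epsilon>' = min 1 (\<epsilon> / M)"
  have \<epsilon>': "\<epsilon>' > 0" "\<epsilon>' \<le> 1" using assms M by (auto simp: \<epsilon>'_def)
  have "\<epsilon>' \<le> \<epsilon> / M" by (simp add: \<epsilon>'_def)
  then have "\<epsilon>' * M \<le> \<epsilon>" using M by (simp add: pos_le_divide_eq)
  then have \<epsilon>'M: "\<epsilon>' * (2 / \<eta>\<^sup>2 + 1) \<le> \<epsilon>" by (simp add: M_def)
  have "\<epsilon>' \<le> \<epsilon>"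
  proof -
    have "\<epsilon>' * 1 \<le> \<epsilon>' * M" using M \<epsilon>' by (intro mult_left_mono) auto
    then show ?thesis using \<open>\<epsilon>' * M \<le> \<epsilon>\<close> by linarith
  qed
  obtain K \<rho> where \<rho>: "0 \<le> \<rho>" and K: "\<And>z. cmod z = 1 \<Longrightarrow> \<eta> \<le> cmod (1 - z) \<Longrightarrow>
    cmod ((\<Sum>k<K. of_real (real (Suc k) * \<rho> ^ Suc k) * z ^ Suc k) - z / (1 - z)\<^sup>2) \<le> \<epsilon>'"
    using abel_koebe_approx[OF assms(1) \<epsilon>'(1)] by blast
  define b where "b k = (if k \<le> K then real k * \<rho> ^ k else 0)" for k
  have b: "b 0 = 0" "0 \<le> b k" for k using \<rho> by (auto simp: b_def)
  define F where "F z = (\<Sum>k\<le>K. complex_of_real (b k) * z ^ k)" for z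
  have F: "cmod (F z + of_real q) \<le> \<epsilon>'"
    if z: "cmod z = 1" "\<eta> \<le> cmod (1 - z)" and q: "q = 1 / (cmod (1 - z))\<^sup>2" for z q
  proof -
    have "F z = (\<Sum>k<K. of_real (real (Suc k) * \<rho> ^ Suc k) * z ^ Suc k)"
      unfolding F_def b_def by (subst sum.atMost_shift) (auto intro!: sum.cong)
    moreover have "z \<noteq> 1" using z assms by auto
    ultimately show ?thesis
      using K[OF z] by (simp add: koebe_on_circle z q)
  qed
  have q: "1 / 4 \<le> 1 / (cmod (1 - z))\<^sup>2" "1 / (cmod (1 - z))\<^sup>2 \<le> 1 / \<eta>\<^sup>2"
    if z: "cmod z = 1" "\<eta> \<le> cmod (1 - z)" for z
  proof -
    have "cmod (1 - z) \<le> 2" using norm_triangle_ineq4[of 1 z] z by simp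
    then have "(cmod (1 - z))\<^sup>2 \<le> 2\<^sup>2" by (intro power_mono) auto
    moreover have \<eta>: "\<eta>\<^sup>2 \<le> (cmod (1 - z))\<^sup>2" "0 < \<eta>\<^sup>2" using z assms by (auto intro: power_mono)
    moreover from \<eta> have "0 < (cmod (1 - z))\<^sup>2" by linarith
    ultimately show "1 / 4 \<le> 1 / (cmod (1 - z))\<^sup>2" "1 / (cmod (1 - z))\<^sup>2 \<le> 1 / \<eta>\<^sup>2"
      using \<eta>
      by (simp add: field_simps, intro frac_le) auto
  qed
  from assms(3) show ?thesis
  proof
    assume s: "s = 1"
    show ?thesis
    proof (intro exI[of _ K] exI[of _ b] conjI allI impI)
      fix z assume z: "cmod z = 1" "\<eta> \<le> cmod (1 - z)"
      show "\<exists>q. 1 / 16 \<le> q \<and> cmod ((\<Sum>k\<le>K. of_real (b k) * z ^ k) + of_real (s * q)) \<le> \<epsilon>"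
        using F[OF z refl] q[OF z] \<open>\<epsilon>' \<le> \<epsilon>\<close> unfolding F_def s
        by (intro exI[of _ "1 / (cmod (1 - z))\<^sup>2"]) auto
    qed (use b in auto)
  next
    assume s: "s = - 1"
    define c where "c r = (\<Sum>k\<le>r. b k * b (r - k))" for r
    show ?thesis
    proof (intro exI[of _ "K + K"] exI[of _ c] conjI allI impI)
      fix z assume z: "cmod z = 1" "\<eta> \<le> cmod (1 - z)"
      define q where "q = 1 / (cmod (1 - z))\<^sup>2"
      have "(\<Sum>k\<le>K + K. of_real (c k) * z ^ k) = F z * F z"
        unfolding F_def c_def of_real_sum of_real_mult
        by (rule polynomial_product[symmetric]) (auto simp: b_def)
      then have "(\<Sum>k\<le>K + K. of_real (c k) * z ^ k) + of_real (s * q\<^sup>2) = (F z + of_real q) * ((F z + of_real q) - 2 * of_real q)"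
        by (simp add: s power2_eq_square algebra_simps)
      also have "cmod \<dots> \<le> \<epsilon>' * (\<epsilon>' + 2 * (1 / \<eta>\<^sup>2))"
        unfolding norm_mult
      proof (intro mult_mono)
        show "cmod (F z + of_real q) \<le> \<epsilon>'" using F[OF z] by (simp add: q_def)
        moreover have "cmod (2 * of_real q) \<le> 2 * (1 / \<eta>\<^sup>2)"
          using q[OF z] unfolding q_def[symmetric] by (simp add: norm_mult)
        ultimately show "cmod (F z + of_real q - 2 * of_real q) \<le> \<epsilon>' + 2 * (1 / \<eta>\<^sup>2)"
          using norm_triangle_ineq4[of "F z + of_real q" "2 * of_real q"] by linarith
      qed (use \<epsilon>' in auto)
      also have "\<dots> \<le> \<epsilon>' * (2 / \<eta>\<^sup>2 + 1)" using \<epsilon>' by (intro mult_left_mono) auto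
      also have "\<dots> \<le> \<epsilon>" by (rule \<epsilon>'M)
      finally have "cmod ((\<Sum>k\<le>K + K. of_real (c k) * z ^ k) + of_real (s * q\<^sup>2)) \<le> \<epsilon>" .
      moreover have "(1 / 4)\<^sup>2 \<le> q\<^sup>2" using q[OF z] unfolding q_def by (intro power_mono) auto
      then have "1 / 16 \<le> q\<^sup>2" by (simp add: power2_eq_square)
      ultimately show "\<exists>q. 1 / 16 \<le> q \<and> cmod ((\<Sum>k\<le>K + K. of_real (c k) * z ^ k) + of_real (s * q)) \<le> \<epsilon>"
        by blast
    qed (use b in \<open>auto simp: c_def intro!: sum_nonneg\<close>)
  qed
qed

text \<open>The sum is the real part of \<open>\<gamma> * F\<close> with
  \<open>\<gamma> = \<alpha> - \<i> \<beta>\<close>. Since \<open>F\<close> is nearly the real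
  number \<open>- sgn \<alpha> * q\<close>, the sine coefficient \<open>\<beta>\<close> affects the
  error term alone.\<close>

lemma trig_polynomial_negative:
  fixes \<alpha> \<beta> :: real
  assumes "0 < \<delta>" "\<delta> < 1 / 2" "\<alpha> \<noteq> 0"
  shows "\<exists>N. \<exists>b :: nat \<Rightarrow> real. b 0 = 0 \<and> (\<forall>k. 0 \<le> b k) \<and> (\<forall>t. \<delta> \<le> dist_int t \<longrightarrow>
      (\<Sum>k\<le>N. b k * (\<alpha> * cos (2 * pi * real k * t) + \<beta> * sin (2 * pi * real k * t))) \<le> - 1)"
proof -
  define \<gamma> where "\<gamma> = Complex \<alpha> (- \<beta>)"
  have \<gamma>: "cmod \<gamma> > 0" using assms by (auto simp: \<gamma>_def complex_eq_iff)
  \<comment> \<open>The error \<open>cmod \<gamma> * \<epsilon>\<close> is half of the guaranteed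
    main term \<open>\<bar>\<alpha>\<bar> / 16\<close>.\<close>
  define \<epsilon> where "\<epsilon> = \<bar>\<alpha>\<bar> / (32 * cmod \<gamma>)"
  define \<eta> where "\<eta> = 2 * sin (pi * \<delta>)"
  have "\<eta> > 0" unfolding \<eta>_def using assms by (intro mult_pos_pos sin_gt_zero) auto
  moreover have "\<epsilon> > 0" unfolding \<epsilon>_def using assms \<gamma> by auto
  moreover have "sgn \<alpha> = 1 \<or> sgn \<alpha> = - 1" using assms by (auto simp: sgn_if)
  ultimately have "\<exists>N. \<exists>b :: nat \<Rightarrow> real. b 0 = 0 \<and> (\<forall>k. 0 \<le> b k) \<and>
    (\<forall>z. cmod z = 1 \<longrightarrow> \<eta> \<le> cmod (1 - z) \<longrightarrow>
      (\<exists>q. 1 / 16 \<le> q \<and> cmod ((\<Sum>k\<le>N. of_real (b k) * z ^ k) + of_real (sgn \<alpha> * q)) \<le> \<epsilon>))"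
    by (rule signed_kernel)
  then obtain N b where b: "b 0 = 0" "\<And>k. 0 \<le> b k" and
    N: "\<And>z. cmod z = 1 \<Longrightarrow> \<eta> \<le> cmod (1 - z) \<Longrightarrow>
      \<exists>q. 1 / 16 \<le> q \<and> cmod ((\<Sum>k\<le>N. of_real (b k) * z ^ k) + of_real (sgn \<alpha> * q)) \<le> \<epsilon>"
    by blast
  have "(\<Sum>k\<le>N. b k * (\<alpha> * cos (2 * pi * real k * t) + \<beta> * sin (2 * pi * real k * t))) \<le> - \<bar>\<alpha>\<bar> / 32"
    if t: "\<delta> \<le> dist_int t" for t
  proof -
    let ?z = "cis (2 * pi * t)"
    define F where "F = (\<Sum>k\<le>N. of_real (b k) * ?z ^ k)"
    have "\<eta> \<le> cmod (1 - ?z)" unfolding \<eta>_def using cis_minus_1_norm_ge assms t by blast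
    with N[of ?z] obtain q where q: "1 / 16 \<le> q" "cmod (F + of_real (sgn \<alpha> * q)) \<le> \<epsilon>"
      by (auto simp: F_def)
    have "?z ^ k = cis (2 * pi * real k * t)" for k
      by (simp add: Complex.DeMoivre mult_ac)
    then have "Re (\<gamma> * F) = (\<Sum>k\<le>N. Re (\<gamma> * (of_real (b k) * cis (2 * pi * real k * t))))"
      by (simp only: F_def sum_distrib_left Re_sum)
    then have "(\<Sum>k\<le>N. b k * (\<alpha> * cos (2 * pi * real k * t) + \<beta> * sin (2 * pi * real k * t))) = Re (\<gamma> * F)"
      by (simp add: \<gamma>_def algebra_simps)
    also have "\<gamma> * F = \<gamma> * (F + of_real (sgn \<alpha> * q)) - \<gamma> * of_real (sgn \<alpha> * q)"
      by (simp add: algebra_simps)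
    also have "Re \<dots> = Re (\<gamma> * (F + of_real (sgn \<alpha> * q))) - \<bar>\<alpha>\<bar> * q"
      by (simp add: \<gamma>_def abs_sgn)
    also have "Re (\<gamma> * (F + of_real (sgn \<alpha> * q))) \<le> cmod \<gamma> * \<epsilon>"
      using complex_Re_le_cmod[of "\<gamma> * (F + of_real (sgn \<alpha> * q))"] mult_left_mono[OF q(2), of "cmod \<gamma>"]
      by (simp add: norm_mult)
    also have "cmod \<gamma> * \<epsilon> = \<bar>\<alpha>\<bar> / 32" using \<gamma> by (simp add: \<epsilon>_def)
    also have "\<bar>\<alpha>\<bar> / 32 - \<bar>\<alpha>\<bar> * q \<le> - \<bar>\<alpha>\<bar> / 32"
      using mult_left_mono[OF q(1), of "\<bar>\<alpha>\<bar>"] by simp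
    finally show ?thesis by simp
  qed
  note bound = this
  show ?thesis
  proof (intro exI[of _ N] exI[of _ "\<lambda>k. 32 / \<bar>\<alpha>\<bar> * b k"] conjI allI impI)
    fix t assume "\<delta> \<le> dist_int t"
    from mult_left_mono[OF bound[OF this], of "32 / \<bar>\<alpha>\<bar>"] assms
    show "(\<Sum>k\<le>N. 32 / \<bar>\<alpha>\<bar> * b k * (\<alpha> * cos (2 * pi * real k * t) + \<beta> * sin (2 * pi * real k * t))) \<le> - 1"
      by (simp add: sum_distrib_left mult.assoc)
  qed (use b in auto)
qed

section \<open>The linear programming bound\<close>

text \<open>Translated by \<open>- x\<close>, the near points form an admissible configuration of
  radius \<open>R\<close>, so their number is bounded independently of \<open>X\<close>.\<close>

lemma card_near_points_le:
  fixes p :: "nat \<Rightarrow> real ^ 'n"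
  assumes N: "\<And>n (q :: nat \<Rightarrow> real ^ 'n). admissible R \<delta> n q \<Longrightarrow> n \<le> N"
    and p: "admissible X \<delta> n p"
  shows "card {j\<in>{1..n}. norm (x - p j) \<le> R} \<le> N"
proof -
  let ?J = "{j\<in>{1..n}. norm (x - p j) \<le> R}"
  obtain h where h: "bij_betw h {1..card ?J} ?J"
    using ex_bij_betw_nat_finite_1[of ?J] by auto
  have "admissible R \<delta> (card ?J) (\<lambda>i. p (h i) - x)"
    unfolding admissible_def
  proof (intro conjI ballI impI)
    fix i assume "i \<in> {1..card ?J}"
    then have "h i \<in> ?J" using h bij_betwE by blast
    then show "p (h i) - x \<in> cball 0 R" by (simp add: norm_minus_commute)
  next
    fix i j assume ij: "i \<in> {1..card ?J}" "j \<in> {1..card ?J}" "i \<noteq> j"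
    then have "h i \<in> ?J" "h j \<in> ?J" "h i \<noteq> h j"
      using h bij_betwE bij_betw_imp_inj_on[OF h] by (blast, blast, auto dest: inj_onD)
    then show "\<delta> \<le> dist_int (norm (p (h i) - x - (p (h j) - x)))"
      using p by (auto simp: admissible_def)
  qed
  then show ?thesis by (rule N)
qed

lemma admissible_bound:
  fixes \<delta> :: real
  assumes "0 < \<delta>" "\<delta> < 1 / 2" and d: "CARD('n::finite) mod 4 \<noteq> 3"
  shows "\<exists>C. \<forall>X\<ge>1. \<forall>n. \<forall>p :: nat \<Rightarrow> real ^ 'n. admissible X \<delta> n p \<longrightarrow>
    real n \<le> C * X powr ((real CARD('n) - 1) / 2)"
proof -
  define d where "d = CARD('n)"
  have "d > 0" by (simp add: d_def)
  define e where "e = (real d - 1) / 2"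
  have e: "e \<ge> 0" using \<open>d > 0\<close> by (simp add: e_def)
  obtain \<alpha> \<beta> where asymp: "Omega_asymp d \<alpha> \<beta>" and "d mod 4 \<noteq> 3 \<longrightarrow> \<alpha> \<noteq> 0"
    using Omega_asymp_exists[OF \<open>d > 0\<close>] by blast
  then have \<alpha>: "\<alpha> \<noteq> 0" using assms(3) by (simp add: d_def)
  from asymp obtain K where K: "\<And>t. t \<ge> 1 \<Longrightarrow> \<bar>t powr e * Omega d t - (\<alpha> * cos t + \<beta> * sin t)\<bar> \<le> K / t"
    unfolding Omega_asymp_def e_def by blast
  have "K \<ge> 0" using K[of 1] by simp
  obtain N b where b: "b 0 = 0" "\<And>k. 0 \<le> b k" and
    N: "\<And>t. \<delta> \<le> dist_int t \<Longrightarrow>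
      (\<Sum>k\<le>N. b k * (\<alpha> * cos (2 * pi * real k * t) + \<beta> * sin (2 * pi * real k * t))) \<le> - 1"
    using trig_polynomial_negative[OF assms(1,2) \<alpha>] by blast
  \<comment> \<open>The weight compensates the decay of \<open>Omega d (2 * pi * k * r)\<close> in
    \<open>k\<close>, so that \<open>r powr e * f r\<close> is the trigonometric polynomial at
    \<open>r\<close> up to \<open>K1 / r\<close>.\<close>
  define a where "a k = b k * (2 * pi * real k) powr e" for k
  have a: "0 \<le> a k" for k using b by (simp add: a_def)
  define f where "f r = (\<Sum>k\<le>N. a k * Omega d (2 * pi * real k * r))" for r
  define F where "F = (\<Sum>k\<le>N. a k)"
  have F: "f (norm x) \<le> F" for x :: "real ^ 'n"
    unfolding f_def F_def
  proof (rule sum_mono)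
    fix k
    have "Omega d (2 * pi * real k * norm x) \<le> 1"
      using Omega_norm_le_1[of "(2 * pi * real k) *\<^sub>R x"] by (simp add: d_def)
    then show "a k * Omega d (2 * pi * real k * norm x) \<le> a k"
      using a[of k] by (rule mult_left_le)
  qed
  have pos_def: "0 \<le> (\<Sum>i\<in>{1..n}. \<Sum>j\<in>{1..n}. f (norm (p i - p j)))" for n and p :: "nat \<Rightarrow> real ^ 'n"
  proof -
    have "0 \<le> (\<Sum>i\<in>{1..n}. \<Sum>j\<in>{1..n}. Omega d (2 * pi * real k * norm (p i - p j)))" for k
      using Omega_positive_definite[of "{1..n}" "\<lambda>i. (2 * pi * real k) *\<^sub>R p i"]
      by (simp add: d_def flip: scaleR_diff_right)
    then have "0 \<le> (\<Sum>k\<le>N. a k * (\<Sum>i\<in>{1..n}. \<Sum>j\<in>{1..n}. Omega d (2 * pi * real k * norm (p i - p j))))"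
      using a by (intro sum_nonneg[of "{..N}"] mult_nonneg_nonneg)
    also have "\<dots> = (\<Sum>i\<in>{1..n}. \<Sum>j\<in>{1..n}. f (norm (p i - p j)))"
      unfolding f_def sum_distrib_left
      by (subst sum.swap, rule sum.cong[OF refl], rule sum.swap)
    finally show ?thesis .
  qed
  define K1 where "K1 = (\<Sum>k\<le>N. b k * K)"
  \<comment> \<open>Beyond \<open>R\<close> the error \<open>K1 / r\<close> uses up at most half of
    the margin 1.\<close>
  define R where "R = max 1 (2 * K1)"
  have far: "f r \<le> - 1 / 2 * r powr - e" if r: "R \<le> r" "\<delta> \<le> dist_int r" for r
  proof -
    have "r \<ge> 1" "K1 / r \<le> 1 / 2" using r by (auto simp: R_def divide_simps)
    have "r powr e * f r = (\<Sum>k\<le>N. b k * ((2 * pi * real k * r) powr e * Omega d (2 * pi * real k * r)))"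
      unfolding f_def a_def sum_distrib_left using \<open>r \<ge> 1\<close> by (simp add: powr_mult mult_ac)
    also have "\<dots> \<le> (\<Sum>k\<le>N. b k * (\<alpha> * cos (2 * pi * real k * r) + \<beta> * sin (2 * pi * real k * r)) + b k * K / r)"
    proof (rule sum_mono)
      fix k
      show "b k * ((2 * pi * real k * r) powr e * Omega d (2 * pi * real k * r))
        \<le> b k * (\<alpha> * cos (2 * pi * real k * r) + \<beta> * sin (2 * pi * real k * r)) + b k * K / r"
      \<comment> \<open>The asymptotics fail at argument 0, hence the requirement
        \<open>b 0 = 0\<close>. For \<open>k \<ge> 1\<close> the argument is at least
        \<open>r \<ge> 1\<close>.\<close>
      proof (cases "k = 0")
        case True
        then show ?thesis by (simp add: b)
      next
        case False
        let ?t = "2 * pi * real k * r"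
        have "1 * 1 \<le> (2 * pi) * real k" using False pi_gt3 by (intro mult_mono) auto
        then have t: "r \<le> ?t" using \<open>r \<ge> 1\<close> by simp
        have "K / ?t \<le> K / r" using t \<open>r \<ge> 1\<close> \<open>K \<ge> 0\<close> by (intro divide_left_mono) auto
        then have "?t powr e * Omega d ?t \<le> (\<alpha> * cos ?t + \<beta> * sin ?t) + K / r"
          using K[of ?t] t \<open>r \<ge> 1\<close> by linarith
        from mult_left_mono[OF this b(2)[of k]] show ?thesis by (simp only: distrib_left times_divide_eq_right)
      qed
    qed
    also have "\<dots> = (\<Sum>k\<le>N. b k * (\<alpha> * cos (2 * pi * real k * r) + \<beta> * sin (2 * pi * real k * r))) + K1 / r"
      by (simp add: sum.distrib K1_def sum_divide_distrib)
    also have "\<dots> \<le> - 1 + 1 / 2" using N[OF r(2)] \<open>K1 / r \<le> 1 / 2\<close> by linarith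
    finally have "r powr e * f r \<le> - 1 / 2" by simp
    then have "r powr - e * (r powr e * f r) \<le> r powr - e * (- 1 / 2)"
      by (intro mult_left_mono) auto
    then have "(r powr - e * r powr e) * f r \<le> r powr - e * (- 1 / 2)"
      by (simp only: mult.assoc)
    moreover have "r powr - e * r powr e = 1" using \<open>r \<ge> 1\<close> by (simp flip: powr_add)
    ultimately show ?thesis by simp
  qed
  obtain M where "\<forall>n\<in>{n. \<exists>p :: nat \<Rightarrow> real ^ 'n. admissible R \<delta> n p}. n \<le> M"
    using finite_admissible[OF assms(1)] unfolding finite_nat_set_iff_bounded_le by blast
  then have M: "n \<le> M" if "admissible R \<delta> n p" for n and p :: "nat \<Rightarrow> real ^ 'n"
    using that by blast
  have "0 \<le> F" unfolding F_def using a by (intro sum_nonneg) auto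
  define C where "C = real M + 2 * (real M * F) * 2 powr e"
  have "real n \<le> C * X powr e" if X: "X \<ge> 1" and p: "admissible X \<delta> n p" for X n and p :: "nat \<Rightarrow> real ^ 'n"
  proof (cases "n = 0")
    case True
    then show ?thesis using \<open>0 \<le> F\<close> by (simp add: C_def)
  next
    case False
    \<comment> \<open>Distances are at most \<open>2 * X\<close>, so \<open>f \<le> - c\<close> at
      every far pair.\<close>
    define c where "c = 1 / 2 * (2 * X) powr - e"
    have "c > 0" using X by (simp add: c_def)
    \<comment> \<open>At most \<open>M\<close> points, \<open>p i\<close> itself included, are near
      and contribute up to \<open>F\<close>; every other one contributes at most
      \<open>- c\<close>.\<close>
    have row: "(\<Sum>j\<in>{1..n}. f (norm (p i - p j))) \<le> real M * F - c * (real n - real M)" if i: "i \<in> {1..n}" for i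
    proof -
      let ?J = "{j\<in>{1..n}. norm (p i - p j) \<le> R}"
      have J: "real (card ?J) \<le> real M" using card_near_points_le[OF M p] by simp
      have "(\<Sum>j\<in>{1..n}. f (norm (p i - p j))) \<le> (\<Sum>j\<in>{1..n}. if j \<in> ?J then F else - c)"
      proof (rule sum_mono)
        fix j assume j: "j \<in> {1..n}"
        show "f (norm (p i - p j)) \<le> (if j \<in> ?J then F else - c)"
        proof (cases "j \<in> ?J")
          case True
          then show ?thesis using F by simp
        next
          case False
          let ?r = "norm (p i - p j)"
          have r: "R \<le> ?r" "0 < ?r" using False j by (auto simp: R_def)
          then have "i \<noteq> j" by auto
          then have "\<delta> \<le> dist_int ?r" using p i j unfolding admissible_def by blast
          with far r have "f ?r \<le> - 1 / 2 * ?r powr - e" by blast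
          moreover have "(2 * X) powr - e \<le> ?r powr - e"
          proof (rule powr_mono2')
            have "norm (p i) \<le> X" "norm (p j) \<le> X" using p i j by (auto simp: admissible_def)
            then show "?r \<le> 2 * X" using norm_triangle_ineq4[of "p i" "p j"] by linarith
          qed (use e r in auto)
          ultimately have "f ?r \<le> - c" by (simp add: c_def)
          then show ?thesis unfolding if_not_P[OF False] .
        qed
      qed
      also have "\<dots> = (\<Sum>j\<in>{1..n}. (if j \<in> ?J then F + c else 0) - c)"
        by (intro sum.cong) auto
      also have "\<dots> = real (card ?J) * (F + c) - real n * c"
        by (simp add: sum_subtractf sum.If_cases Int_def conj_ac)
      also have "\<dots> \<le> real M * (F + c) - real n * c"
        using J \<open>0 \<le> F\<close> \<open>c > 0\<close> by (intro diff_right_mono mult_right_mono) auto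
      finally show ?thesis by (simp add: algebra_simps)
    qed
    \<comment> \<open>Positive definiteness against the sum of the row bounds, which are all equal;
      as \<open>n > 0\<close>, a single one is nonnegative.\<close>
    have "0 \<le> (\<Sum>i\<in>{1..n}. real M * F - c * (real n - real M))"
      by (rule order_trans[OF pos_def[where n = n and p = p]], rule sum_mono, rule row)
    then have "0 \<le> real M * F - c * (real n - real M)"
      using False by (simp add: zero_le_mult_iff)
    then have "real n - real M \<le> real M * F / c"
      using \<open>c > 0\<close> by (simp add: field_simps)
    also have "real M * F / c = 2 * (real M * F) * 2 powr e * X powr e"
      using X by (simp add: c_def powr_minus powr_mult divide_simps)
    finally have "real n \<le> real M + 2 * (real M * F) * 2 powr e * X powr e" by simp
    moreover have "real M * 1 \<le> real M * X powr e"
      using X e by (intro mult_left_mono ge_one_powr_ge_zero) auto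
    ultimately show ?thesis by (simp add: C_def algebra_simps)
  qed
  then show ?thesis unfolding e_def d_def by blast
qed

text \<open>If \<open>d \<equiv> 3\<close> (mod 4) then \<open>Omega d\<close> is asymptotically a pure sine; one more dimension restores the cosine.\<close>

lemma admissible_embed_option:
  fixes p :: "nat \<Rightarrow> real ^ 'n"
  assumes "admissible X \<delta> n p"
  shows "\<exists>q :: nat \<Rightarrow> real ^ 'n option. admissible X \<delta> n q"
proof -
  define \<iota> :: "real ^ 'n \<Rightarrow> real ^ 'n option" where "\<iota> x = (\<chi> i. case i of None \<Rightarrow> 0 | Some j \<Rightarrow> x $ j)" for x
  have norm: "norm (\<iota> x) = norm x" for x
    unfolding norm_vec_def L2_set_def by (simp add: \<iota>_def UNIV_option_conv sum.reindex)
  have diff: "\<iota> x - \<iota> y = \<iota> (x - y)" for x y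
    by (simp add: \<iota>_def vec_eq_iff split: option.split)
  have "admissible X \<delta> n (\<lambda>i. \<iota> (p i))"
    using assms by (simp add: admissible_def diff norm)
  then show ?thesis by blast
qed

theorem theorem1p2:
  fixes \<delta> :: real
  assumes "0 < \<delta>" and "\<delta> < 1 / 2"
  shows "(\<lambda>X::real. real (Max_points TYPE('n::finite) X \<delta>)) \<in> O[at_top](growth CARD('n))"
proof -
  define d where "d = CARD('n)"
  define N where "N X = Max_points TYPE('n) X \<delta>" for X
  have N: "\<exists>p :: nat \<Rightarrow> real ^ 'n. admissible X \<delta> (N X) p" for X
    unfolding N_def by (rule Max_points_attained[OF assms(1)])
  show ?thesis
  proof (cases "d mod 4 = 3")
    case True
    \<comment> \<open>In dimension \<open>d + 1\<close> the exponent is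
      \<open>((d + 1) - 1) / 2 = d / 2\<close>.\<close>
    then have "CARD('n option) mod 4 \<noteq> 3" by (simp add: d_def card_option) presburger
    from admissible_bound[OF assms this] obtain C where
      "\<And>X n (p :: nat \<Rightarrow> real ^ 'n option). X \<ge> 1 \<Longrightarrow> admissible X \<delta> n p \<Longrightarrow> real n \<le> C * X powr (real d / 2)"
      by (auto simp: card_option d_def)
    with N admissible_embed_option have "real (N X) \<le> C * X powr (real d / 2)" if "X \<ge> 1" for X
      using that by metis
    then show ?thesis using True unfolding N_def d_def
      by (intro bigoI[of _ C] eventually_mono[OF eventually_ge_at_top[of 1]]) (auto simp: growth_def)
  next
    case False
    from admissible_bound[OF assms this[unfolded d_def]] obtain C where
      C: "\<And>X n (p :: nat \<Rightarrow> real ^ 'n). X \<ge> 1 \<Longrightarrow> admissible X \<delta> n p \<Longrightarrow> real n \<le> C * X powr ((real d - 1) / 2)"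
      by (auto simp: d_def)
    \<comment> \<open>From \<open>exp 1\<close> on the logarithm is at least 1, so the bound without
      it implies the one for \<open>d\<close> divisible by 4.\<close>
    have "real (N X) \<le> C * growth d X" if X: "X \<ge> exp 1" for X
    proof -
      have "X \<ge> 1" using X exp_ge_add_one_self[of 1] by linarith
      with C N have NC: "real (N X) \<le> C * X powr ((real d - 1) / 2)" by metis
      have "0 < X powr ((real d - 1) / 2)" using \<open>X \<ge> 1\<close> by simp
      have "0 \<le> C * X powr ((real d - 1) / 2)" using NC by (rule order_trans[OF of_nat_0_le_iff])
      with \<open>0 < X powr ((real d - 1) / 2)\<close> have "C \<ge> 0" by (simp add: zero_le_mult_iff)
      have "ln X \<ge> 1" using X \<open>X \<ge> 1\<close> by (simp add: ln_ge_iff)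
      then have "X powr ((real d - 1) / 2) * 1 \<le> X powr ((real d - 1) / 2) * ln X"
        by (intro mult_left_mono) auto
      then have "X powr ((real d - 1) / 2) \<le> growth d X" using False by (simp add: growth_def)
      with NC mult_left_mono[OF this \<open>C \<ge> 0\<close>] show ?thesis by linarith
    qed
    moreover have "C * growth d X \<le> \<bar>C\<bar> * \<bar>growth d X\<bar>" for X
      unfolding abs_mult[symmetric] by (rule abs_ge_self)
    ultimately show ?thesis unfolding N_def d_def
      by (intro bigoI[of _ "\<bar>C\<bar>"] eventually_mono[OF eventually_ge_at_top[of "exp 1"]])
        (auto intro: order_trans)
  qed
qed

end
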